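(* Let $n\geq 1$, and let $K\subset \mathbb{R}^n$ be a closed convex set with Gaussian measure $\gamma_n(K) > 0$. Then $$\alpha(B_2^n ,K)\leq f(\gamma_n(K)),\qquad\text{where}\qquad f(p)= \begin{cases} \dfrac{1}{2\Psi^{-1}(p)} & \text{if } p\in (0, \tfrac{1}{2}], \\[2mm] \dfrac{1}{2\Psi^{-1}(1/2)} & \text{if } p \in (\tfrac{1}{2}, 1]. \end{cases}$$
   Context: $\gamma_n$ is the standard Gaussian probability measure on $\mathbb{R}^n$, with density $(2\pi)^{-n/2}e^{-|x|^2/2}$. $B_2^n$ is the closed Euclidean unit ball of $\mathbb{R}^n$. $\Psi:[0,\infty)\to[0,1)$ is the increasing bijection $\Psi(x)=\gamma_1([-x,x])$. An $n$-lattice is a discrete subgroup of $\mathbb{R}^n$ spanning $\mathbb{R}^n$, equivalently a set $A\mathbb{Z}^n$ with $A\in GL_n(\mathbb{R})$. For an $n$-lattice $L$ and a closed convex set $V\subset\mathbb{R}^n$ with nonempty interior, the covering radius is $\mu(L,V)=\inf\{c>0: L+cV=\mathbb{R}^n\}$ (Minkowski sum). For a closed convex set $U\subset\mathbb{R}^n$ with $0\in\mathrm{int}(U)$, the last successive minimum $\lambda_n(L,U)$ is the least $c>0$ such that $L\cap cU$ contains $n$ linearly independent vectors. Define $$\alpha(U,V)=\sup_{L \text{ an } n\text{-lattice}}\frac{\mu(L,V)}{\lambda_n(L,U)}.$$ *)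

theory Defs
  imports "HOL-Analysis.Analysis"
begin

text \<open>On the one-dimensional space \<^typ>\<open>real\<close> the norm is the absolute value, so the same
  definition also yields the measure on the line used in the function Psi below.\<close>

definition gaussian_measure :: "'a::euclidean_space measure" where
  "gaussian_measure = density lborel
     (\<lambda>x. ennreal ((2 * pi) powr (- real DIM('a) / 2) * exp (- (norm x)\<^sup>2 / 2)))"

definition Psi :: "real \<Rightarrow> real" where
  "Psi x = measure gaussian_measure {- x..x}"

definition Psi_inv :: "real \<Rightarrow> real" where
  "Psi_inv = the_inv_into {0..} Psi"

definition full_lattice :: "'a::euclidean_space set \<Rightarrow> bool" where
  "full_lattice L \<longleftrightarrow>
     0 \<in> L \<and> (\<forall>x\<in>L. \<forall>y\<in>L. x + y \<in> L) \<and> (\<forall>x\<in>L. - x \<in> L) \<and> discrete L \<and> span L = UNIV"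

text \<open>The infimum is taken in the extended reals, so that it is infinite when no dilate of \<open>V\<close>
  works; this does not happen when \<open>V\<close> has nonempty interior. The addition is the Minkowski sum.\<close>

definition covering_radius :: "'a::euclidean_space set \<Rightarrow> 'a set \<Rightarrow> ereal" where
  "covering_radius L V = Inf (ereal ` {c. c > 0 \<and> L + (*\<^sub>R) c ` V = UNIV})"

text \<open>The least element exists when \<open>U\<close> is compact with the origin in its interior.\<close>

definition last_successive_minimum :: "'a::euclidean_space set \<Rightarrow> 'a set \<Rightarrow> real" where
  "last_successive_minimum L U =
     (LEAST c. c > 0 \<and> (\<exists>S. S \<subseteq> L \<inter> (*\<^sub>R) c ` U \<and> independent S \<and> card S = DIM('a)))"

definition alpha :: "'a::euclidean_space set \<Rightarrow> 'a set \<Rightarrow> ereal" where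
  "alpha U V =
     (SUP L\<in>{L. full_lattice L}. covering_radius L V / ereal (last_successive_minimum L U))"

definition gaussian_bound :: "real \<Rightarrow> real" where
  "gaussian_bound p = (if p \<le> 1 / 2 then 1 / (2 * Psi_inv p) else 1 / (2 * Psi_inv (1 / 2)))"

end

theory Submission
  imports Defs "HOL-Probability.Probability" "HOL-Real_Asymp.Real_Asymp"
begin

text \<open>Rescaling turns the claim into the following: if a lattice \<open>L\<close> contains \<open>n\<close> independent vectors of
  length at most \<open>2 w\<close>, where \<open>\<Psi>(w) \<le> 1/2\<close>, and \<open>K\<close> is convex with \<open>\<gamma>(K) > \<Psi>(w)\<close>, then
  \<open>L + K\<close> is the whole space. Passing from \<open>K\<close> to the union \<open>K'\<close> of the lines in direction \<open>u\<close> that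
  meet \<open>K\<close> in a chord of length at least \<open>|u|\<close> loses nothing modulo \<open>u\<close>, so the claim follows by
  induction on the number of generators once \<open>\<gamma>(K') > \<Psi>(w)\<close> is known for \<open>|u| \<le> 2 w\<close>.

  For the latter let \<open>F(t)\<close> be the measure of the union of the lines whose chord is longer than \<open>2 t\<close>.
  Then \<open>\<gamma>(K) \<le> E F(|Z|)\<close> for a standard normal \<open>Z\<close>, and \<open>\<Phi>\<^sup>-\<^sup>1 \<circ> F\<close> is concave by Ehrhard's inequality.
  If \<open>F(w) \<le> p = \<Psi>(w)\<close>, concavity yields \<open>p F(w - \<delta>) + (1 - p) F(w + \<delta>) \<le> p\<close>, which averages to
  \<open>E F(|Z|) \<le> p\<close>.

  Ehrhard's inequality is obtained by Borell's argument: the midpoint concavity of \<open>\<Phi>\<^sup>-\<^sup>1\<close> of three solutions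
  of the heat equation is preserved in time, by the maximum principle.\<close>

section \<open>The Gaussian measure and its distribution function\<close>

text \<open>The weights \<open>p\<close> and \<open>1 - p\<close> come from two extremal bodies of
  measure p. If K is the open slab |x . e| < w, then F drops from 1 to 0 at w; if K is invariant
  under u, then F is constantly p. Both give equality in the two-point bound and in its average. The
  bound on the measure of K by the average of F holds line by line: the coordinate along u is
  standard normal, and among intervals of equal length the centred one has the largest measure. The
  restriction \<open>p \<le> 1 / 2\<close>, which produces the plateau of f, enters twice:
  log-concavity is applied at \<open>\<alpha> \<le> - \<alpha>\<close>, where
  \<open>Phi \<alpha> = p\<close>, and the averaging uses that the odds (1 - p) / p are at least 1.
  In the maximum principle the obstacles are that the inverse of \<open>Phi\<close> is infinite at 0
  and 1 and that space is not compact. Therefore the initial data run between \<open>Phi l\<close>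
  and \<open>Phi N\<close> and are constant near infinity, and the third one is given the higher
  floor \<open>Phi ((N + l) / 2)\<close>. Strict inequalities between measures suffice throughout,
  as the infimum in the covering radius leaves room for a slightly smaller w.\<close>

definition gaussian_density :: "'a::euclidean_space \<Rightarrow> real" where
  "gaussian_density x = (2 * pi) powr (- real DIM('a) / 2) * exp (- (norm x)\<^sup>2 / 2)"

lemma gaussian_measure_eq_density:
  "gaussian_measure = density lborel (\<lambda>x. ennreal (gaussian_density x))"
  by (simp add: gaussian_measure_def gaussian_density_def)

lemma gaussian_density_pos: "gaussian_density x > 0"
  by (simp add: gaussian_density_def)

lemma gaussian_density_nonneg [simp]: "gaussian_density x \<ge> 0"
  by (simp add: gaussian_density_def)

lemma continuous_on_gaussian_density [continuous_intros]:
  assumes "continuous_on A f"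
  shows "continuous_on A (\<lambda>x. gaussian_density (f x))"
  unfolding gaussian_density_def by (intro continuous_intros assms) auto

lemma borel_measurable_gaussian_density [measurable]:
  "gaussian_density \<in> borel_measurable borel"
  by (intro borel_measurable_continuous_onI continuous_intros)

lemma sets_gaussian_measure [simp, measurable_cong]: "sets gaussian_measure = sets borel"
  by (simp add: gaussian_measure_eq_density)

lemma space_gaussian_measure [simp]: "space gaussian_measure = UNIV"
  by (simp add: gaussian_measure_eq_density)

lemma gaussian_density_eq_prod:
  "gaussian_density (x::'a::euclidean_space) = (\<Prod>b\<in>Basis. std_normal_density (x \<bullet> b))"
proof -
  have "sqrt (2 * pi) ^ DIM('a) = (2 * pi) powr (real DIM('a) / 2)"
    by (subst powr_half_sqrt[symmetric], simp, subst powr_power, simp_all)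
  then have "(2 * pi) powr (- real DIM('a) / 2) = (1 / sqrt (2 * pi)) ^ DIM('a)"
    by (simp only: minus_divide_left[symmetric] powr_minus_divide power_one_over)
  moreover have "exp (- (norm x)\<^sup>2 / 2) = (\<Prod>b\<in>Basis. exp (- (x \<bullet> b)\<^sup>2 / 2))"
  proof -
    have "- (norm x)\<^sup>2 / 2 = (\<Sum>b\<in>Basis. - (x \<bullet> b)\<^sup>2 / 2)"
      unfolding power2_norm_eq_inner by (subst euclidean_inner)
        (simp add: sum_divide_distrib sum_negf power2_eq_square)
    then show ?thesis by (simp add: exp_sum)
  qed
  ultimately show ?thesis
    by (simp add: gaussian_density_def std_normal_density_def prod.distrib prod_constant
        power_one_over prod_dividef)
qed

lemma prob_space_gaussian_measure: "prob_space (gaussian_measure :: 'a::euclidean_space measure)"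
proof
  have *: "(\<integral>\<^sup>+x. ennreal (std_normal_density x) \<partial>lborel) = 1"
    using prob_space.emeasure_space_1[OF prob_space_normal_density[of 1 0]]
    by (simp add: emeasure_density)
  have "emeasure gaussian_measure (space gaussian_measure :: 'a set)
      = (\<integral>\<^sup>+(x::'a). ennreal (gaussian_density x) \<partial>lborel)"
    by (simp add: gaussian_measure_eq_density emeasure_density)
  also have "\<dots> = (\<integral>\<^sup>+(x::'a). (\<Prod>b\<in>Basis. ennreal (std_normal_density (x \<bullet> b))) \<partial>lborel)"
    by (simp add: gaussian_density_eq_prod prod_ennreal)
  also have "\<dots> = (\<Prod>b\<in>(Basis::'a set). \<integral>\<^sup>+x. ennreal (std_normal_density x) \<partial>lborel)"
    by (intro nn_integral_lborel_prod) auto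
  finally show "emeasure gaussian_measure (space gaussian_measure :: 'a set) = 1"
    unfolding * by (simp only: prod.neutral_const)
qed

interpretation gauss: prob_space "gaussian_measure :: 'a::euclidean_space measure"
  by (rule prob_space_gaussian_measure)

lemma emeasure_gaussian_measure:
  "A \<in> sets borel \<Longrightarrow> emeasure gaussian_measure A
     = (\<integral>\<^sup>+x. ennreal (gaussian_density x) * indicator A x \<partial>lborel)"
  by (simp add: gaussian_measure_eq_density emeasure_density)

lemma gaussian_density_minus [simp]: "gaussian_density (- x) = gaussian_density x"
  by (simp add: gaussian_density_def)

lemma measure_gaussian_uminus:
  fixes A :: "'a::euclidean_space set"
  assumes [measurable]: "A \<in> sets borel"
  shows "measure gaussian_measure (uminus ` A) = measure gaussian_measure A"
proof -
  have im: "uminus ` A = uminus -` A"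
    by (auto simp: image_iff) (metis minus_minus)
  have [measurable]: "uminus -` A \<in> sets borel"
    using measurable_sets[of "uminus :: 'a \<Rightarrow> 'a" borel borel A] by simp
  have "lborel = distr lborel borel (uminus :: 'a \<Rightarrow> 'a)"
    using lborel_affine[of "-1" "0::'a"] by (simp add: density_1 comp_def fun_Compl_def)
  then have "(\<integral>\<^sup>+x. ennreal (gaussian_density x) * indicator A x \<partial>lborel)
    = (\<integral>\<^sup>+x. ennreal (gaussian_density x) * indicator A x \<partial>distr lborel borel uminus)"
    by simp
  also have "\<dots> = (\<integral>\<^sup>+x. ennreal (gaussian_density x) * indicator (uminus -` A) x \<partial>lborel)"
    by (subst nn_integral_distr) (auto simp: indicator_def)
  finally show ?thesis
    by (simp add: im measure_def emeasure_gaussian_measure)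
qed

section \<open>The standard normal distribution function and its inverse\<close>

definition Phi :: "real \<Rightarrow> real" where
  "Phi x = measure gaussian_measure {..x}"

lemma measure_gaussian_Icc:
  "measure gaussian_measure {a..b} = integral {a..b} (gaussian_density :: real \<Rightarrow> real)"
proof -
  have "measure gaussian_measure {a..b} = (LINT x:{a..b}|lborel. gaussian_density x)"
    unfolding measure_def set_lebesgue_integral_def
    by (subst integral_eq_nn_integral)
      (auto simp: emeasure_gaussian_measure indicator_def intro!: arg_cong[where f=enn2real] nn_integral_cong)
  also have "\<dots> = integral {a..b} gaussian_density"
    by (intro set_borel_integral_eq_integral(2) borel_integrable_atLeastAtMost' continuous_intros)
  finally show ?thesis .
qed

interpretation gauss_real: real_distribution "gaussian_measure :: real measure"
  by (simp add: real_distribution_def real_distribution_axioms_def prob_space_gaussian_measure)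

lemma Phi_eq_cdf: "Phi = cdf gaussian_measure"
  by (auto simp: Phi_def cdf_def)

lemma measure_gaussian_singleton [simp]: "measure gaussian_measure {x::real} = 0"
  using measure_gaussian_Icc[of x x] by simp

lemma Phi_diff_eq_integral:
  assumes "a \<le> b"
  shows "Phi b - Phi a = integral {a..b} (gaussian_density :: real \<Rightarrow> real)"
proof -
  have "{..b} = {..<a} \<union> {a..b}" "{..a} = {..<a} \<union> {a}"
    using assms by auto
  then have "Phi b = measure gaussian_measure {..<a} + measure gaussian_measure {a..b}"
    "Phi a = measure gaussian_measure {..<a} + measure gaussian_measure {a}"
    unfolding Phi_def by (simp_all only:) (subst gauss.finite_measure_Union; force)+
  then show ?thesis
    by (simp add: measure_gaussian_Icc)
qed

lemma Phi_has_real_derivative: "(Phi has_real_derivative gaussian_density x) (at x)"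
proof -
  have "((\<lambda>t. integral {x-1..t} gaussian_density) has_real_derivative gaussian_density x) (at x within {x-1..x+1})"
    by (intro integral_has_real_derivative continuous_intros) auto
  then have "((\<lambda>t. Phi (x-1) + integral {x-1..t} gaussian_density) has_real_derivative gaussian_density x)
      (at x within {x-1..x+1})"
    by (auto intro!: derivative_eq_intros)
  then have "(Phi has_real_derivative gaussian_density x) (at x within {x-1..x+1})"
    by (rule has_field_derivative_transform_within[where d=1])
      (auto simp flip: Phi_diff_eq_integral)
  moreover have "at x within {x-1..x+1} = at x"
    by (rule at_within_interior) auto
  ultimately show ?thesis by simp
qed

lemmas Phi_has_real_derivative' [derivative_intros] = Phi_has_real_derivative[THEN DERIV_chain2]

lemma Phi_strict_mono: "x < y \<Longrightarrow> Phi x < Phi y"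
  by (erule DERIV_pos_imp_increasing[where f=Phi])
    (rule exI, rule conjI, rule Phi_has_real_derivative, rule gaussian_density_pos)

lemma Phi_less_iff [simp]: "Phi x < Phi y \<longleftrightarrow> x < y"
  using strict_mono_less[of Phi] Phi_strict_mono by (auto simp: strict_mono_def)

lemma Phi_le_iff [simp]: "Phi x \<le> Phi y \<longleftrightarrow> x \<le> y"
  by (simp flip: not_less)

lemma Phi_eq_iff [simp]: "Phi x = Phi y \<longleftrightarrow> x = y"
  by (auto simp: order_eq_iff)

lemma isCont_Phi: "isCont Phi x"
  by (rule DERIV_isCont) (rule Phi_has_real_derivative)

lemma continuous_on_Phi [continuous_intros]:
  "continuous_on A f \<Longrightarrow> continuous_on A (\<lambda>x. Phi (f x))"
  by (rule continuous_on_compose2[of UNIV Phi]) (auto intro: continuous_at_imp_continuous_on isCont_Phi)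

lemma Phi_at_top: "(Phi \<longlongrightarrow> 1) at_top"
  unfolding Phi_eq_cdf by (rule gauss_real.cdf_lim_at_top_prob)

lemma Phi_at_bot: "(Phi \<longlongrightarrow> 0) at_bot"
  unfolding Phi_eq_cdf by (rule gauss_real.cdf_lim_at_bot)

lemma Phi_pos [simp]: "0 < Phi x"
  by (rule le_less_trans[OF _ Phi_strict_mono[of "x - 1" x]]) (auto simp: Phi_def)

lemma Phi_less_1 [simp]: "Phi x < 1"
  by (rule less_le_trans[OF Phi_strict_mono[of x "x + 1"]]) (auto simp: Phi_def)

lemma Phi_surj:
  assumes "0 < p" "p < 1"
  obtains x where "Phi x = p"
proof -
  obtain a where a: "Phi a < p"
    using order_tendstoD(2)[OF Phi_at_bot assms(1)] by (auto simp: eventually_at_bot_linorder)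
  obtain b where b: "p < Phi b"
    using order_tendstoD(1)[OF Phi_at_top assms(2)] by (auto simp: eventually_at_top_linorder)
  have "a \<le> b"
    using a b by (metis Phi_le_iff less_le_not_le order_trans linear)
  with a b show ?thesis
    using IVT'[of Phi a p b] that by (force intro: continuous_intros)
qed

lemma Phi_minus: "Phi (- x) = 1 - Phi x"
proof -
  have "measure gaussian_measure (uminus ` {..<x}) = measure gaussian_measure {..<x}"
    by (rule measure_gaussian_uminus) auto
  moreover have "measure gaussian_measure {..x} = measure gaussian_measure {..<x} + measure gaussian_measure {x}"
    by (subst gauss.finite_measure_Union[symmetric]) (auto intro!: arg_cong[where f="measure _"])
  moreover have "measure gaussian_measure {..-x} = 1 - measure gaussian_measure {-x<..}"
    by (subst gauss.prob_compl[symmetric]) (auto intro!: arg_cong[where f="measure _"])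
  ultimately show ?thesis
    by (simp add: Phi_def)
qed

lemma Phi_0: "Phi 0 = 1 / 2"
  using Phi_minus[of 0] by simp

text \<open>Log-concavity of \<open>Phi\<close>: the ratio of \<open>Phi (t - s)\<close> to
  \<open>Phi t\<close> increases with t. The ratio of the densities also increases and equals
  \<open>c\<close> at \<open>t = a\<close>. Left of a it is at most c, which integrates from minus
  infinity to \<open>Phi (a - s) \<le> c * Phi a\<close>; right of a it is at least c, so
  \<open>Phi (b - s) - Phi (a - s) \<ge> c * (Phi b - Phi a)\<close>.\<close>

lemma Phi_shift_ratio:
  assumes "a \<le> b" "s \<ge> 0"
  shows "Phi (a - s) * Phi b \<le> Phi (b - s) * Phi a"
proof -
  define c where "c = exp (a * s - s\<^sup>2 / 2)"
  define g where "g t = Phi (t - s) - c * Phi t" for t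
  have g': "(g has_real_derivative gaussian_density t * (exp (t * s - s\<^sup>2 / 2) - c)) (at t)" for t
  proof -
    have "gaussian_density (t - s) = gaussian_density t * exp (t * s - s\<^sup>2 / 2)"
      by (simp add: gaussian_density_def flip: exp_add) (simp add: power2_eq_square field_simps)
    then show ?thesis
      unfolding g_def by (auto intro!: derivative_eq_intros simp: algebra_simps)
  qed
  have "g t \<ge> g a" if "t \<le> a" for t
    using that
  proof (rule DERIV_nonpos_imp_nonincreasing[where f=g])
    fix u assume "t \<le> u" "u \<le> a"
    then have "exp (u * s - s\<^sup>2 / 2) \<le> c"
      using assms by (simp add: c_def mult_right_mono)
    then show "\<exists>y. (g has_real_derivative y) (at u) \<and> y \<le> 0"
      using g'[of u] by (auto intro!: exI mult_nonneg_nonpos)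
  qed
  moreover have "(g \<longlongrightarrow> 0 - c * 0) at_bot"
    unfolding g_def
    by (intro tendsto_intros Phi_at_bot filterlim_compose[OF Phi_at_bot]) real_asymp
  ultimately have ga: "g a \<le> 0"
    by (intro tendsto_lowerbound[of g 0 at_bot "g a"]) (auto simp: eventually_at_bot_linorder intro!: exI[of _ a])
  have gb: "g a \<le> g b"
    using assms(1)
  proof (rule DERIV_nonneg_imp_nondecreasing[where f=g])
    fix u assume "a \<le> u" "u \<le> b"
    then have "exp (u * s - s\<^sup>2 / 2) \<ge> c"
      using assms by (simp add: c_def mult_right_mono)
    then show "\<exists>y. (g has_real_derivative y) (at u) \<and> y \<ge> 0"
      using g'[of u] by (auto intro!: exI mult_nonneg_nonneg)
  qed
  have "Phi (a - s) * (Phi b - Phi a) \<le> c * Phi a * (Phi b - Phi a)"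
    using ga assms(1) by (intro mult_right_mono) (auto simp: g_def)
  also have "\<dots> \<le> (Phi (b - s) - Phi (a - s)) * Phi a"
    using mult_right_mono[OF gb, of "Phi a"] by (simp add: g_def algebra_simps less_imp_le)
  finally show ?thesis
    by (simp add: algebra_simps)
qed

text \<open>A total function with unspecified values outside (0, 1); hence the range conditions that
  accompany it.\<close>

definition Phi_inv :: "real \<Rightarrow> real" where
  "Phi_inv = the_inv Phi"

lemma Phi_inv_Phi [simp]: "Phi_inv (Phi x) = x"
  unfolding Phi_inv_def by (rule the_inv_f_f) (auto simp: inj_def)

lemma Phi_Phi_inv [simp]: "0 < p \<Longrightarrow> p < 1 \<Longrightarrow> Phi (Phi_inv p) = p"
  by (metis Phi_inv_Phi Phi_surj)

lemma Phi_inv_has_real_derivative: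
  assumes "0 < p" "p < 1"
  shows "(Phi_inv has_real_derivative inverse (gaussian_density (Phi_inv p))) (at p)"
proof (rule DERIV_inverse_function[where a=0 and b=1])
  show "(Phi has_real_derivative gaussian_density (Phi_inv p)) (at (Phi_inv p))"
    by (rule Phi_has_real_derivative)
  show "gaussian_density (Phi_inv p) \<noteq> 0"
    using gaussian_density_pos[of "Phi_inv p"] by simp
  have "isCont Phi_inv (Phi (Phi_inv p))"
    by (rule isCont_inverse_function[where d=1]) (auto simp: isCont_Phi)
  with assms show "isCont Phi_inv p" by simp
qed (use assms in auto)

lemma continuous_on_Phi_inv [continuous_intros]:
  assumes "continuous_on A f" "\<And>x. x \<in> A \<Longrightarrow> 0 < f x" "\<And>x. x \<in> A \<Longrightarrow> f x < 1"
  shows "continuous_on A (\<lambda>x. Phi_inv (f x))"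
proof (rule continuous_on_compose2[of "{0<..<1}" Phi_inv])
  show "continuous_on {0<..<1} Phi_inv"
    by (auto intro!: continuous_at_imp_continuous_on DERIV_isCont Phi_inv_has_real_derivative)
qed (use assms in auto)

lemma Phi_inv_le_iff: "0 < p \<Longrightarrow> p < 1 \<Longrightarrow> Phi_inv p \<le> a \<longleftrightarrow> p \<le> Phi a"
  by (metis Phi_Phi_inv Phi_le_iff)

lemma le_Phi_inv_iff: "0 < p \<Longrightarrow> p < 1 \<Longrightarrow> a \<le> Phi_inv p \<longleftrightarrow> Phi a \<le> p"
  by (metis Phi_Phi_inv Phi_le_iff)

lemma gaussian_density_real_derivative [derivative_intros]:
  assumes "(f has_real_derivative f') (at x within S)"
  shows "((\<lambda>x. gaussian_density (f x :: real)) has_real_derivative - f x * gaussian_density (f x) * f') (at x within S)"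
proof -
  define c where "c = (2 * pi) powr (- real DIM(real) / 2)"
  have eq: "gaussian_density t = c * exp (- t\<^sup>2 / 2)" for t :: real
    by (simp add: gaussian_density_def c_def)
  show ?thesis
    using assms unfolding eq by (auto intro!: derivative_eq_intros)
qed

section \<open>The heat semigroup\<close>

text \<open>For bounded continuous f this is the solution of the heat equation with generator half
  the Laplacian and initial value f, written as an expectation. This form is meaningful at
  \<open>s = 0\<close>; at \<open>s = 1\<close> and \<open>x = 0\<close> it is the Gaussian integral
  of f.\<close>

definition heat :: "('a::euclidean_space \<Rightarrow> real) \<Rightarrow> real \<Rightarrow> 'a \<Rightarrow> real" where
  "heat f s x = (\<integral>z. f (x + sqrt s *\<^sub>R z) \<partial>gaussian_measure)"

definition heat_kernel :: "real \<Rightarrow> 'a::euclidean_space \<Rightarrow> real" where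
  "heat_kernel s z = (2 * pi * s) powr (- real DIM('a) / 2) * exp (- (z \<bullet> z) / (2 * s))"

lemma measurable_gaussian_measure [simp]: "measurable gaussian_measure N = measurable borel N"
  by (rule measurable_cong_sets) simp_all

lemma measure_gaussian_UNIV [simp]: "measure (gaussian_measure :: 'a::euclidean_space measure) UNIV = 1"
  using gauss.prob_space by simp

lemma integrable_gaussian_bounded:
  fixes f :: "'a::euclidean_space \<Rightarrow> real"
  assumes "f \<in> borel_measurable borel" "\<And>x. \<bar>f x\<bar> \<le> B"
  shows "integrable gaussian_measure f"
  using assms by (intro gauss.integrable_const_bound[where B=B]) auto

lemma heat_measurable:
  fixes f :: "'a::euclidean_space \<Rightarrow> real"
  assumes "continuous_on UNIV f"
  shows "(\<lambda>z. f (x + sqrt s *\<^sub>R z)) \<in> borel_measurable borel"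
  by (intro borel_measurable_continuous_onI continuous_on_compose2[OF assms] continuous_intros) auto

lemma heat_0 [simp]: "heat f 0 x = f x"
  by (simp add: heat_def gauss.prob_space)

lemma integrable_heat:
  fixes f :: "'a::euclidean_space \<Rightarrow> real"
  assumes "continuous_on UNIV f" "\<And>x. lo \<le> f x" "\<And>x. f x \<le> hi"
  shows "integrable gaussian_measure (\<lambda>z. f (x + sqrt s *\<^sub>R z))"
proof (rule integrable_gaussian_bounded[where B="\<bar>lo\<bar> + \<bar>hi\<bar>"])
  show "\<bar>f (x + sqrt s *\<^sub>R z)\<bar> \<le> \<bar>lo\<bar> + \<bar>hi\<bar>" for z
    using assms(2,3)[of "x + sqrt s *\<^sub>R z"] by linarith
qed (rule heat_measurable[OF assms(1)])

lemma heat_bounds: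
  fixes f :: "'a::euclidean_space \<Rightarrow> real"
  assumes "continuous_on UNIV f" "\<And>x. lo \<le> f x" "\<And>x. f x \<le> hi"
  shows "lo \<le> heat f s x" "heat f s x \<le> hi"
proof -
  note int = integrable_heat[OF assms]
  show "lo \<le> heat f s x"
    unfolding heat_def using gauss.integral_ge_const[OF int] assms by simp
  show "heat f s x \<le> hi"
    unfolding heat_def using gauss.integral_le_const[OF int] assms by simp
qed

text \<open>Dominated convergence with a constant majorant. The time \<open>s = 0\<close> is
  included because the maximum principle looks for a minimum on a compact set that contains the
  initial time.\<close>

lemma continuous_on_heat:
  fixes f :: "'a::euclidean_space \<Rightarrow> real"
  assumes f: "continuous_on UNIV f" "\<And>x. lo \<le> f x" "\<And>x. f x \<le> hi"
  shows "continuous_on ({0..} \<times> UNIV) (\<lambda>(s, x). heat f s x)"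
proof (rule continuous_on_sequentiallyI)
  fix u :: "nat \<Rightarrow> real \<times> 'a" and a
  assume u: "\<forall>n. u n \<in> {0..} \<times> UNIV" "a \<in> {0..} \<times> UNIV" "u \<longlonglongrightarrow> a"
  have "(\<lambda>n. \<integral>z. f (snd (u n) + sqrt (fst (u n)) *\<^sub>R z) \<partial>gaussian_measure)
        \<longlonglongrightarrow> (\<integral>z. f (snd a + sqrt (fst a) *\<^sub>R z) \<partial>gaussian_measure)"
  proof (rule integral_dominated_convergence[where w="\<lambda>_. \<bar>lo\<bar> + \<bar>hi\<bar>"])
    show "AE z in gaussian_measure. (\<lambda>n. f (snd (u n) + sqrt (fst (u n)) *\<^sub>R z))
            \<longlonglongrightarrow> f (snd a + sqrt (fst a) *\<^sub>R z)"
    proof (intro AE_I2 isCont_tendsto_compose[of _ f])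
      show "isCont f (snd a + sqrt (fst a) *\<^sub>R z)" for z
        using f(1) continuous_on_eq_continuous_at[of UNIV] by blast
      show "(\<lambda>n. snd (u n) + sqrt (fst (u n)) *\<^sub>R z) \<longlonglongrightarrow> snd a + sqrt (fst a) *\<^sub>R z" for z
        by (intro tendsto_intros u)
    qed
    show "AE z in gaussian_measure. norm (f (snd (u n) + sqrt (fst (u n)) *\<^sub>R z)) \<le> \<bar>lo\<bar> + \<bar>hi\<bar>" for n
    proof (rule AE_I2)
      show "norm (f (snd (u n) + sqrt (fst (u n)) *\<^sub>R z)) \<le> \<bar>lo\<bar> + \<bar>hi\<bar>" for z
        using f(2,3)[of "snd (u n) + sqrt (fst (u n)) *\<^sub>R z"] unfolding real_norm_def by linarith
    qed
  qed (use heat_measurable[OF f(1)] in auto)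
  then show "(\<lambda>n. case u n of (s, x) \<Rightarrow> heat f s x) \<longlonglongrightarrow> (case a of (s, x) \<Rightarrow> heat f s x)"
    by (simp add: heat_def case_prod_beta)
qed

lemma gaussian_tail_small:
  assumes "\<epsilon> > 0"
  obtains R where "R > 0" "measure gaussian_measure {z::'a::euclidean_space. R \<le> norm z} < \<epsilon>"
proof -
  have "(\<lambda>n. measure gaussian_measure {z::'a. real n \<le> norm z})
      \<longlonglongrightarrow> measure gaussian_measure (\<Inter>n. {z::'a. real n \<le> norm z})"
    by (intro gauss.finite_Lim_measure_decseq) (auto simp: decseq_def)
  moreover have "(\<Inter>n. {z::'a. real n \<le> norm z}) = {}"
    by (auto simp: not_le) (metis reals_Archimedean2 not_less)
  ultimately have "eventually (\<lambda>n. measure gaussian_measure {z::'a. real n \<le> norm z} < \<epsilon>) sequentially"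
    using assms by (auto intro: order_tendstoD)
  then obtain N where "\<forall>n\<ge>N. measure gaussian_measure {z::'a. real n \<le> norm z} < \<epsilon>"
    by (auto simp: eventually_sequentially)
  then have "measure gaussian_measure {z::'a. real (Suc N) \<le> norm z} < \<epsilon>"
    using le_Suc_eq by blast
  then show ?thesis
    using that[of "real (Suc N)"] by simp
qed

text \<open>Uniformity in s: for \<open>s \<le> 1\<close> and distant x, the point
  \<open>x + sqrt s *\<^sub>R z\<close> can reach the ball where f may differ from c only if z is
  itself long, and long z have small measure.\<close>

lemma heat_at_infinity:
  fixes f :: "'a::euclidean_space \<Rightarrow> real"
  assumes f: "continuous_on UNIV f" "\<And>x. lo \<le> f x" "\<And>x. f x \<le> hi"
    and c: "\<And>x. r \<le> norm x \<Longrightarrow> f x = c" and "\<epsilon> > 0"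
  obtains R where "\<And>s x. 0 \<le> s \<Longrightarrow> s \<le> 1 \<Longrightarrow> R \<le> norm x \<Longrightarrow> heat f s x \<le> c + \<epsilon>"
proof -
  define B where "B = \<bar>hi\<bar> + \<bar>c\<bar> + 1"
  have "B > 0" by (simp add: B_def)
  obtain R0 where R0: "measure gaussian_measure {z::'a. R0 \<le> norm z} < \<epsilon> / B"
    using gaussian_tail_small[of "\<epsilon> / B"] \<open>\<epsilon> > 0\<close> \<open>B > 0\<close> by (metis divide_pos_pos)
  have "heat f s x \<le> c + \<epsilon>" if s: "0 \<le> s" "s \<le> 1" and x: "R0 + r \<le> norm x" for s and x :: 'a
  proof -
    have "f (x + sqrt s *\<^sub>R z) \<le> c + B * indicator {z. R0 \<le> norm z} z" for z
    proof (cases "r \<le> norm (x + sqrt s *\<^sub>R z)")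
      case True
      then show ?thesis using c \<open>B > 0\<close> by (simp add: indicator_def)
    next
      case False
      have "norm x \<le> norm (x + sqrt s *\<^sub>R z) + norm (sqrt s *\<^sub>R z)"
        using norm_triangle_ineq4[of "x + sqrt s *\<^sub>R z" "sqrt s *\<^sub>R z"] by simp
      moreover have "norm (sqrt s *\<^sub>R z) \<le> norm z"
        using s mult_right_mono[of "sqrt s" 1 "norm z"] by simp
      ultimately have "R0 \<le> norm z"
        using False x by linarith
      moreover have "f (x + sqrt s *\<^sub>R z) \<le> c + B"
        using f(3)[of "x + sqrt s *\<^sub>R z"] by (simp add: B_def)
      ultimately show ?thesis by simp
    qed
    then have "heat f s x \<le> (\<integral>z. c + B * indicator {z::'a. R0 \<le> norm z} z \<partial>gaussian_measure)"
      unfolding heat_def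
      by (intro integral_mono integrable_heat[OF f] Bochner_Integration.integrable_add
          integrable_gaussian_bounded[where B=B]) (auto simp: indicator_def B_def)
    also have "\<dots> = c + B * measure gaussian_measure {z::'a. R0 \<le> norm z}"
    proof -
      have "integrable gaussian_measure (\<lambda>z::'a. B * indicator {z. R0 \<le> norm z} z)"
        by (intro integrable_gaussian_bounded[where B=B]) (auto simp: indicator_def B_def)
      then show ?thesis
        by (subst Bochner_Integration.integral_add) auto
    qed
    also have "\<dots> \<le> c + \<epsilon>"
      using R0 \<open>B > 0\<close> by (simp add: field_simps)
    finally show ?thesis .
  qed
  then show ?thesis using that by blast
qed

section \<open>The heat kernel and the derivatives of the heat flow\<close>

lemma continuous_on_heat_kernel [continuous_intros]:
  assumes "continuous_on A u" "continuous_on A v" "\<And>x. x \<in> A \<Longrightarrow> u x > 0"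
  shows "continuous_on A (\<lambda>x. heat_kernel (u x) (v x))"
  unfolding heat_kernel_def using assms by (intro continuous_intros) force+

text \<open>Subtracting the value c at infinity leaves a function supported in the box. The
  convolution is thus an integral over a compact box, to which the Leibniz rule applies. The
  substitution is the scaling by \<open>sqrt s\<close>.\<close>

lemma heat_eq_kernel:
  fixes f :: "'a::euclidean_space \<Rightarrow> real"
  assumes f: "continuous_on UNIV f" and c: "\<And>x. x \<notin> cbox a b \<Longrightarrow> f x = c" and "s > 0"
    and bd: "\<And>x. lo \<le> f x" "\<And>x. f x \<le> hi"
  shows "heat f s x = c + integral (cbox a b) (\<lambda>y. (f y - c) * heat_kernel s (y - x))"
proof -
  define G where "G y = (f y - c) * heat_kernel s (y - x)" for y
  have contG: "continuous_on UNIV G"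
    unfolding G_def using \<open>s > 0\<close> by (intro continuous_intros f) auto
  then have [measurable]: "G \<in> borel_measurable borel"
    by (rule borel_measurable_continuous_onI)
  have dens: "\<bar>sqrt s\<bar> ^ DIM('a) * heat_kernel s (sqrt s *\<^sub>R z) = gaussian_density z" for z :: 'a
  proof -
    have "\<bar>sqrt s\<bar> ^ DIM('a) = s powr (real DIM('a) / 2)"
      using \<open>s > 0\<close> by (simp add: powr_half_sqrt[symmetric] powr_power)
    moreover have "(2 * pi * s) powr (- real DIM('a) / 2)
        = (2 * pi) powr (- real DIM('a) / 2) * s powr (- real DIM('a) / 2)"
      using \<open>s > 0\<close> by (subst powr_mult) auto
    moreover have "s powr (real DIM('a) / 2) * s powr (- real DIM('a) / 2) = 1"
      using \<open>s > 0\<close> by (simp flip: powr_add)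
    moreover have "(sqrt s *\<^sub>R z) \<bullet> (sqrt s *\<^sub>R z) = s * (norm z)\<^sup>2"
      using \<open>s > 0\<close> by (simp add: power2_norm_eq_inner)
    ultimately show ?thesis
      using \<open>s > 0\<close> by (simp add: heat_kernel_def gaussian_density_def)
  qed
  have "heat f s x - c = (\<integral>z. f (x + sqrt s *\<^sub>R z) - c \<partial>gaussian_measure)"
    unfolding heat_def by (subst Bochner_Integration.integral_diff)
      (auto intro: integrable_heat[OF f bd] simp: gauss.prob_space)
  also have "\<dots> = (\<integral>z. gaussian_density z *\<^sub>R (f (x + sqrt s *\<^sub>R z) - c) \<partial>lborel)"
    unfolding gaussian_measure_eq_density
    by (rule integral_density) (auto intro!: borel_measurable_diff heat_measurable[OF f])
  also have "\<dots> = (\<integral>z. \<bar>sqrt s\<bar> ^ DIM('a) *\<^sub>R G (x + sqrt s *\<^sub>R z) \<partial>lborel)"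
    by (intro Bochner_Integration.integral_cong) (auto simp: G_def simp flip: dens)
  also have "\<dots> = (\<integral>y. G y \<partial>density (distr lborel borel (\<lambda>z. x + sqrt s *\<^sub>R z)) (\<lambda>_. \<bar>sqrt s\<bar> ^ DIM('a)))"
    by (simp add: integral_density integral_distr)
  also have "\<dots> = (\<integral>y. G y \<partial>lborel)"
    using lborel_affine[of "sqrt s" x] \<open>s > 0\<close> by (simp add: ennreal_power)
  also have "\<dots> = (\<integral>y. indicator (cbox a b) y *\<^sub>R G y \<partial>lborel)"
    using c by (intro Bochner_Integration.integral_cong) (auto simp: indicator_def G_def)
  also have "\<dots> = integral (cbox a b) G"
    using set_borel_integral_eq_integral(2)[of "cbox a b" G]
      borel_integrable_compact[OF compact_cbox continuous_on_subset[OF contG]]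
    by (simp add: set_integrable_def set_lebesgue_integral_def)
  finally show ?thesis unfolding G_def[abs_def] by simp
qed


text \<open>The derivative of the kernel along \<open>- e\<close>: the kernel will be evaluated at
  \<open>y - x\<close>, and it is x that moves along e.\<close>

definition heat_kernel_D :: "'a::euclidean_space \<Rightarrow> real \<Rightarrow> 'a \<Rightarrow> real" where
  "heat_kernel_D e s z = (z \<bullet> e) / s * heat_kernel s z"

definition heat_kernel_DD :: "'a::euclidean_space \<Rightarrow> real \<Rightarrow> 'a \<Rightarrow> real" where
  "heat_kernel_DD e s z = ((z \<bullet> e)\<^sup>2 / s\<^sup>2 - 1 / s) * heat_kernel s z"

lemma heat_kernel_space_derivative:
  assumes "s > 0" "norm e = 1"
  shows "((\<lambda>\<tau>. heat_kernel s (z - \<tau> *\<^sub>R e)) has_real_derivative heat_kernel_D e s (z - \<tau> *\<^sub>R e)) (at \<tau>)"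
proof -
  have ee: "e \<bullet> e = 1"
    using assms by (simp add: norm_eq_1)
  have eq: "(z - \<tau> *\<^sub>R e) \<bullet> (z - \<tau> *\<^sub>R e) = z \<bullet> z - 2 * \<tau> * (z \<bullet> e) + \<tau>\<^sup>2" for \<tau>
    by (simp add: inner_diff ee inner_commute power2_eq_square algebra_simps)
  show ?thesis
    unfolding heat_kernel_def heat_kernel_D_def eq using assms(1)
    by (auto intro!: derivative_eq_intros simp: ee inner_diff_left field_simps)
qed

lemma heat_kernel_D_space_derivative:
  assumes "s > 0" "norm e = 1"
  shows "((\<lambda>\<tau>. heat_kernel_D e s (z - \<tau> *\<^sub>R e)) has_real_derivative heat_kernel_DD e s (z - \<tau> *\<^sub>R e)) (at \<tau>)"
proof -
  have ee: "e \<bullet> e = 1"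
    using assms by (simp add: norm_eq_1)
  show ?thesis
    unfolding heat_kernel_D_def heat_kernel_DD_def using assms(1)
    by (auto intro!: derivative_eq_intros heat_kernel_space_derivative[OF assms]
        simp: heat_kernel_D_def ee inner_diff_left field_simps power2_eq_square)
qed

lemma heat_kernel_time_derivative:
  fixes z :: "'a::euclidean_space"
  assumes "s > 0"
  shows "((\<lambda>s. heat_kernel s z) has_real_derivative (\<Sum>e\<in>Basis. heat_kernel_DD e s z) / 2) (at s)"
proof -
  have zz: "(\<Sum>e\<in>Basis. (z \<bullet> e)\<^sup>2) = z \<bullet> z"
    by (subst euclidean_inner[of z z]) (simp add: power2_eq_square)
  have "(\<Sum>e\<in>Basis. heat_kernel_DD e s z) = (z \<bullet> z / s\<^sup>2 - real DIM('a) / s) * heat_kernel s z"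
    unfolding heat_kernel_DD_def sum_distrib_right[symmetric]
    by (simp add: sum_subtractf zz flip: sum_divide_distrib)
  moreover have "((\<lambda>s. heat_kernel s z) has_real_derivative
      (z \<bullet> z / s\<^sup>2 - real DIM('a) / s) * heat_kernel s z / 2) (at s)"
  proof -
    define m where "m = - real DIM('a) / 2"
    have m: "real DIM('a) = - 2 * m" by (simp add: m_def)
    have pw: "((\<lambda>s. (2 * pi * s) powr m) has_real_derivative m / s * (2 * pi * s) powr m) (at s)"
      using assms by (auto intro!: derivative_eq_intros simp: powr_diff field_simps)
    have ex: "((\<lambda>s. exp (- (z \<bullet> z) / (2 * s))) has_real_derivative
        (z \<bullet> z) / (2 * s\<^sup>2) * exp (- (z \<bullet> z) / (2 * s))) (at s)"
      using assms by (auto intro!: derivative_eq_intros simp: field_simps power2_eq_square)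
    show ?thesis
      unfolding heat_kernel_def m_def[symmetric]
      by (rule DERIV_cong[OF DERIV_mult[OF pw ex]]) (simp add: m field_simps)
  qed
  ultimately show ?thesis by simp
qed

text \<open>Derivatives along lines in arbitrary unit directions suffice, since the tests at a
  minimum are one-dimensional. The heat equation is inherited from the kernel by differentiating
  under the integral.\<close>

lemma heat_has_derivatives:
  fixes f :: "'a::euclidean_space \<Rightarrow> real"
  assumes f: "continuous_on UNIV f" and c: "\<And>x. r \<le> norm x \<Longrightarrow> f x = c"
    and bd: "\<And>x. lo \<le> f x" "\<And>x. f x \<le> hi"
  obtains f1 f2 where
    "\<And>e s x \<tau>. s > 0 \<Longrightarrow> norm e = 1 \<Longrightarrow>
       ((\<lambda>\<tau>. heat f s (x + \<tau> *\<^sub>R e)) has_real_derivative f1 e s (x + \<tau> *\<^sub>R e)) (at \<tau>)"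
    "\<And>e s x \<tau>. s > 0 \<Longrightarrow> norm e = 1 \<Longrightarrow>
       ((\<lambda>\<tau>. f1 e s (x + \<tau> *\<^sub>R e)) has_real_derivative f2 e s (x + \<tau> *\<^sub>R e)) (at \<tau>)"
    "\<And>s x. s > 0 \<Longrightarrow> ((\<lambda>s. heat f s x) has_real_derivative (\<Sum>e\<in>Basis. f2 e s x) / 2) (at s)"
proof -
  obtain b where b: "cball (0::'a) \<bar>r\<bar> \<subseteq> cbox (- b) b"
    using bounded_subset_cbox_symmetric[OF bounded_cball] by blast
  have cb: "f x = c" if "x \<notin> cbox (- b) b" for x
  proof (rule c)
    show "r \<le> norm x" using b that by (force simp: subset_iff)
  qed
  define conv where "conv k x = integral (cbox (- b) b) (\<lambda>y. (f y - c) * k (y - x))" for k :: "'a \<Rightarrow> real" and x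
  have heat_eq: "heat f s x = c + conv (heat_kernel s) x" if "s > 0" for s x
    unfolding conv_def using heat_eq_kernel[OF f cb that bd] .
  have conv_space: "((\<lambda>\<tau>. conv k (x + \<tau> *\<^sub>R e)) has_real_derivative conv k' (x + \<tau> *\<^sub>R e)) (at \<tau>)"
    if "continuous_on UNIV k" "continuous_on UNIV k'"
      "\<And>z \<tau>. ((\<lambda>\<tau>. k (z - \<tau> *\<^sub>R e)) has_real_derivative k' (z - \<tau> *\<^sub>R e)) (at \<tau>)"
    for k k' x \<tau> e
    unfolding conv_def
  proof (rule leibniz_rule_field_derivative[where U=UNIV])
    fix t y
    show "((\<lambda>\<tau>. (f y - c) * k (y - (x + \<tau> *\<^sub>R e))) has_real_derivative
        (f y - c) * k' (y - (x + t *\<^sub>R e))) (at t)"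
      using that(3)[of "y - x" t] by (auto intro!: derivative_eq_intros simp: algebra_simps)
  next
    show "(\<lambda>y. (f y - c) * k (y - (x + t *\<^sub>R e))) integrable_on cbox (- b) b" for t
      by (intro integrable_continuous continuous_intros continuous_on_compose2[OF that(1)]
          continuous_on_subset[OF f]) auto
    show "continuous_on (UNIV \<times> cbox (- b) b) (\<lambda>(t, y). (f y - c) * k' (y - (x + t *\<^sub>R e)))"
      unfolding case_prod_beta
      by (intro continuous_intros continuous_on_compose2[OF that(2)] continuous_on_compose2[OF f]) auto
  qed auto
  have conv_time: "((\<lambda>s. conv (heat_kernel s) x) has_real_derivative
      conv (\<lambda>z. (\<Sum>e\<in>Basis. heat_kernel_DD e s z) / 2) x) (at s)" if "s > 0" for s x
  proof -
    have "((\<lambda>s. conv (heat_kernel s) x) has_real_derivative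
      conv (\<lambda>z. (\<Sum>e\<in>Basis. heat_kernel_DD e s z) / 2) x) (at s within {0<..})"
      unfolding conv_def
    proof (rule leibniz_rule_field_derivative[where U="{0<..}"])
      fix t :: real and y assume "t \<in> {0<..}"
      then show "((\<lambda>s. (f y - c) * heat_kernel s (y - x)) has_real_derivative
          (f y - c) * ((\<Sum>e\<in>Basis. heat_kernel_DD e t (y - x)) / 2)) (at t within {0<..})"
        by (intro DERIV_cmult has_field_derivative_at_within[OF heat_kernel_time_derivative]) auto
      from \<open>t \<in> {0<..}\<close> show "(\<lambda>y. (f y - c) * heat_kernel t (y - x)) integrable_on cbox (- b) b"
        by (intro integrable_continuous continuous_intros continuous_on_subset[OF f]) auto
    next
      show "continuous_on ({0<..} \<times> cbox (- b) b)
          (\<lambda>(t, y). (f y - c) * ((\<Sum>e\<in>Basis. heat_kernel_DD e t (y - x)) / 2))"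
        unfolding case_prod_beta heat_kernel_DD_def
        by (intro continuous_intros continuous_on_compose2[OF f]) auto
    qed (use that in auto)
    moreover have "at s within {0<..} = at s"
      using that by (intro at_within_open) auto
    ultimately show ?thesis by simp
  qed
  have conv_sum: "conv (\<lambda>z. (\<Sum>e\<in>Basis. heat_kernel_DD e s z) / 2) x = (\<Sum>e\<in>Basis. conv (heat_kernel_DD e s) x) / 2"
    if "s > 0" for s x
  proof -
    have "conv (\<lambda>z. (\<Sum>e\<in>Basis. heat_kernel_DD e s z) / 2) x
      = integral (cbox (- b) b) (\<lambda>y. \<Sum>e\<in>Basis. (f y - c) * heat_kernel_DD e s (y - x) / 2)"
      unfolding conv_def by (simp add: sum_distrib_left sum_divide_distrib)
    also have "\<dots> = (\<Sum>e\<in>Basis. integral (cbox (- b) b) (\<lambda>y. (f y - c) * heat_kernel_DD e s (y - x) / 2))"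
      unfolding heat_kernel_DD_def using that
      by (intro integral_sum integrable_continuous continuous_intros continuous_on_subset[OF f]) auto
    finally show ?thesis by (simp add: conv_def sum_divide_distrib)
  qed
  have ck: "continuous_on UNIV (heat_kernel s)" "continuous_on UNIV (heat_kernel_D e s)"
    "continuous_on UNIV (heat_kernel_DD e s)" if "s > 0" for s and e :: 'a
  proof -
    show ck0: "continuous_on UNIV (heat_kernel s)"
      using that by (intro continuous_intros) auto
    show "continuous_on UNIV (heat_kernel_D e s)" "continuous_on UNIV (heat_kernel_DD e s)"
      unfolding heat_kernel_D_def heat_kernel_DD_def using that by (intro continuous_intros ck0; auto)+
  qed
  show thesis
  proof (rule that[of "\<lambda>e s x. conv (heat_kernel_D e s) x" "\<lambda>e s x. conv (heat_kernel_DD e s) x"])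
    fix e :: 'a and s :: real and x :: 'a and \<tau> :: real assume s: "s > 0" and e: "norm e = 1"
    show "((\<lambda>\<tau>. heat f s (x + \<tau> *\<^sub>R e)) has_real_derivative conv (heat_kernel_D e s) (x + \<tau> *\<^sub>R e)) (at \<tau>)"
      unfolding heat_eq[OF s]
      using conv_space[OF ck(1)[OF s] ck(2)[OF s] heat_kernel_space_derivative[OF s e]]
      by (auto intro!: derivative_eq_intros)
    show "((\<lambda>\<tau>. conv (heat_kernel_D e s) (x + \<tau> *\<^sub>R e)) has_real_derivative conv (heat_kernel_DD e s) (x + \<tau> *\<^sub>R e)) (at \<tau>)"
      using conv_space[OF ck(2)[OF s] ck(3)[OF s] heat_kernel_D_space_derivative[OF s e]] .
  next
    fix s :: real and x :: 'a assume s: "s > 0"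
    have "((\<lambda>s. c + conv (heat_kernel s) x) has_real_derivative (\<Sum>e\<in>Basis. conv (heat_kernel_DD e s) x) / 2) (at s)"
      using conv_time[OF s, of x] unfolding conv_sum[OF s] by (auto intro!: derivative_eq_intros)
    then show "((\<lambda>s. heat f s x) has_real_derivative (\<Sum>e\<in>Basis. conv (heat_kernel_DD e s) x) / 2) (at s)"
      by (rule has_field_derivative_transform_within_open[where S="{0<..}"]) (use s heat_eq in auto)
  qed
qed

section \<open>Ehrhard's inequality\<close>

text \<open>\<open>Phi_inv\<close> takes the place that the logarithm has in the heat flow proof of
  the Prekopa-Leindler inequality, whence the name.\<close>

definition log_heat :: "('a::euclidean_space \<Rightarrow> real) \<Rightarrow> real \<Rightarrow> 'a \<Rightarrow> real" where
  "log_heat f s x = Phi_inv (heat f s x)"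

text \<open>The bounds m and N are those of \<open>Phi_inv\<close> applied to f. They keep the heat
  flow away from 0 and 1, where \<open>Phi_inv\<close> degenerates; constancy near infinity confines
  the maximum principle to a compact set.\<close>

locale heat_datum =
  fixes f :: "'a::euclidean_space \<Rightarrow> real" and m N :: real
  assumes continuous: "continuous_on UNIV f"
    and lower: "Phi m \<le> f x" and upper: "f x \<le> Phi N"
    and constant_at_infinity: "\<exists>r. \<forall>x. r \<le> norm x \<longrightarrow> f x = Phi m"
begin

lemma heat_in_range: "0 < heat f s x" "heat f s x < 1"
  using heat_bounds[OF continuous lower upper, of s x] Phi_pos[of m] Phi_less_1[of N] by linarith+

lemma log_heat_bounds: "m \<le> log_heat f s x" "log_heat f s x \<le> N"
  using heat_bounds[OF continuous lower upper, of s x] heat_in_range[of s x]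
  by (auto simp: log_heat_def le_Phi_inv_iff Phi_inv_le_iff)

lemma continuous_on_log_heat: "continuous_on ({0..} \<times> UNIV) (\<lambda>(s, x). log_heat f s x)"
  unfolding log_heat_def case_prod_beta
  by (intro continuous_intros continuous_on_heat[OF continuous lower upper, unfolded case_prod_beta] heat_in_range)

lemma log_heat_at_infinity:
  assumes "\<epsilon> > 0"
  obtains R where "\<And>s x. 0 \<le> s \<Longrightarrow> s \<le> 1 \<Longrightarrow> R \<le> norm x \<Longrightarrow> log_heat f s x \<le> m + \<epsilon>"
proof -
  obtain r where r: "\<And>x. r \<le> norm x \<Longrightarrow> f x = Phi m"
    using constant_at_infinity by blast
  have "Phi (m + \<epsilon>) - Phi m > 0"
    using assms by simp
  from heat_at_infinity[OF continuous lower upper r this]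
  obtain R where R: "\<And>s x. 0 \<le> s \<Longrightarrow> s \<le> 1 \<Longrightarrow> R \<le> norm x \<Longrightarrow> heat f s x \<le> Phi m + (Phi (m + \<epsilon>) - Phi m)"
    by blast
  show thesis
  proof (rule that)
    fix s :: real and x :: 'a assume "0 \<le> s" "s \<le> 1" "R \<le> norm x"
    then show "log_heat f s x \<le> m + \<epsilon>"
      using R[of s x] by (simp add: log_heat_def Phi_inv_le_iff heat_in_range)
  qed
qed

text \<open>The nonlinear evolution equation \<open>w\<^sub>s = (\<Delta>w - w |\<nabla>w|\<^sup>2) / 2\<close> of \<open>w = \<Phi>\<^sup>-\<^sup>1 u\<close> for a
  solution \<open>u\<close> of the heat equation.\<close>

lemma log_heat_has_derivatives:
  obtains w1 w2 where
    "\<And>e s x \<tau>. s > 0 \<Longrightarrow> norm e = 1 \<Longrightarrow>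
       ((\<lambda>\<tau>. log_heat f s (x + \<tau> *\<^sub>R e)) has_real_derivative w1 e s (x + \<tau> *\<^sub>R e)) (at \<tau>)"
    "\<And>e s x \<tau>. s > 0 \<Longrightarrow> norm e = 1 \<Longrightarrow>
       ((\<lambda>\<tau>. w1 e s (x + \<tau> *\<^sub>R e)) has_real_derivative w2 e s (x + \<tau> *\<^sub>R e)) (at \<tau>)"
    "\<And>s x. s > 0 \<Longrightarrow> ((\<lambda>s. log_heat f s x) has_real_derivative
       (\<Sum>e\<in>Basis. w2 e s x - log_heat f s x * (w1 e s x)\<^sup>2) / 2) (at s)"
proof -
  obtain r where "\<And>x. r \<le> norm x \<Longrightarrow> f x = Phi m"
    using constant_at_infinity by blast
  from heat_has_derivatives[OF continuous this lower upper]
  obtain f1 f2 where f1: "\<And>e s x \<tau>. s > 0 \<Longrightarrow> norm e = 1 \<Longrightarrow>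
       ((\<lambda>\<tau>. heat f s (x + \<tau> *\<^sub>R e)) has_real_derivative f1 e s (x + \<tau> *\<^sub>R e)) (at \<tau>)"
    and f2: "\<And>e s x \<tau>. s > 0 \<Longrightarrow> norm e = 1 \<Longrightarrow>
       ((\<lambda>\<tau>. f1 e s (x + \<tau> *\<^sub>R e)) has_real_derivative f2 e s (x + \<tau> *\<^sub>R e)) (at \<tau>)"
    and ft: "\<And>s x. s > 0 \<Longrightarrow> ((\<lambda>s. heat f s x) has_real_derivative (\<Sum>e\<in>Basis. f2 e s x) / 2) (at s)"
    by blast
  define d where "d s x = gaussian_density (log_heat f s x)" for s x
  have d: "d s x > 0" for s x
    by (simp add: d_def gaussian_density_pos)
  define w1 where "w1 e s x = f1 e s x / d s x" for e s x
  \<comment> \<open>The second summand comes from differentiating the denominator: the density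
    \<phi> satisfies \<phi>'(w) = - w \<phi>(w).\<close>
  define w2 where "w2 e s x = f2 e s x / d s x + log_heat f s x * (w1 e s x)\<^sup>2" for e s x
  have deriv: "((\<lambda>t. Phi_inv (u t)) has_real_derivative u' / gaussian_density (Phi_inv (u t))) (at t)"
    if "(u has_real_derivative u') (at t)" "0 < u t" "u t < 1" for u u' t
    using DERIV_chain2[OF Phi_inv_has_real_derivative[OF that(2,3)] that(1)] by (simp add: field_simps)
  have D1: "((\<lambda>\<tau>. log_heat f s (x + \<tau> *\<^sub>R e)) has_real_derivative w1 e s (x + \<tau> *\<^sub>R e)) (at \<tau>)"
    if "s > 0" "norm e = 1" for e s x \<tau>
    using deriv[OF f1[OF that]] heat_in_range by (simp add: log_heat_def w1_def d_def)
  show thesis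
  proof (rule that[of w1 w2])
    fix e :: 'a and s :: real and x :: 'a and \<tau> :: real assume *: "s > 0" "norm e = 1"
    show "((\<lambda>\<tau>. log_heat f s (x + \<tau> *\<^sub>R e)) has_real_derivative w1 e s (x + \<tau> *\<^sub>R e)) (at \<tau>)"
      using * by (rule D1)
    show "((\<lambda>\<tau>. w1 e s (x + \<tau> *\<^sub>R e)) has_real_derivative w2 e s (x + \<tau> *\<^sub>R e)) (at \<tau>)"
      unfolding w1_def[of e s] d_def
      by (rule derivative_eq_intros f2[OF *] D1[OF *] refl)+
        (use d[of s "x + \<tau> *\<^sub>R e"] in \<open>auto simp: w1_def w2_def d_def[symmetric] field_simps power2_eq_square\<close>)
  next
    fix s :: real and x :: 'a assume s: "s > 0"
    have "((\<lambda>s. log_heat f s x) has_real_derivative (\<Sum>e\<in>Basis. f2 e s x) / 2 / d s x) (at s)"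
      using deriv[OF ft[OF s]] heat_in_range by (simp add: log_heat_def d_def)
    moreover have "(\<Sum>e\<in>Basis. f2 e s x) / 2 / d s x
        = (\<Sum>e\<in>Basis. w2 e s x - log_heat f s x * (w1 e s x)\<^sup>2) / 2"
      by (simp add: w2_def sum_divide_distrib mult.commute)
    ultimately show "((\<lambda>s. log_heat f s x) has_real_derivative
       (\<Sum>e\<in>Basis. w2 e s x - log_heat f s x * (w1 e s x)\<^sup>2) / 2) (at s)" by (rule DERIV_cong)
  qed
qed

end

section \<open>The maximum principle for the concavity defect\<close>

lemma second_derivative_nonneg_at_minimum:
  fixes g g' :: "real \<Rightarrow> real"
  assumes g: "\<And>t. (g has_real_derivative g' t) (at t)"
    and g': "(g' has_real_derivative A) (at 0)"
    and min: "\<And>t. g 0 \<le> g t"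
  shows "A \<ge> 0"
proof (rule ccontr)
  assume "\<not> A \<ge> 0"
  have "g' 0 = 0"
    by (rule DERIV_local_min[OF g, of 1]) (use min in auto)
  then obtain d where d: "d > 0" "\<And>h. 0 < h \<Longrightarrow> h < d \<Longrightarrow> g' h < 0"
    using DERIV_neg_dec_right[OF g'] \<open>\<not> A \<ge> 0\<close> by auto
  obtain z where z: "0 < z" "z < d / 2" "g (d / 2) - g 0 = (d / 2 - 0) * g' z"
    using MVT2[of 0 "d / 2" g g'] g d(1) by auto
  have "(d / 2 - 0) * g' z < 0"
    using d z by (intro mult_pos_neg) auto
  then show False
    using min[of "d / 2"] z(3) by linarith
qed

text \<open>The defect \<open>D\<close> lives on pairs (x, y), and a negative value at time 1 is
  refuted at a minimum over time and pairs. The floor \<open>(N + l) / 2\<close> of the third datum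
  secures that minimum: if x or y is far away, its term is near l while the other is at most N, so
  the average barely exceeds this floor.\<close>

lemma log_heat_midpoint:
  fixes f g h :: "'a::euclidean_space \<Rightarrow> real"
  assumes f: "heat_datum f l N" and g: "heat_datum g l N" and h: "heat_datum h ((N + l) / 2) N"
    and init: "\<And>x y. (Phi_inv (f x) + Phi_inv (g y)) / 2 \<le> Phi_inv (h ((1 / 2) *\<^sub>R (x + y)))"
  shows "(log_heat f 1 0 + log_heat g 1 0) / 2 \<le> log_heat h 1 0"
proof (rule ccontr)
  interpret f: heat_datum f l N by fact
  interpret g: heat_datum g l N by fact
  interpret h: heat_datum h "(N + l) / 2" N by fact
  define D where "D s x y = log_heat h s ((1 / 2) *\<^sub>R (x + y)) - log_heat f s x / 2 - log_heat g s y / 2" for s x y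
  assume "\<not> ?thesis"
  then have neg: "D 1 0 0 < 0"
    by (simp add: D_def)
  \<comment> \<open>Half of the deficit: the added term \<open>\<epsilon> * s\<close> still leaves
    \<open>E\<close> equal to \<open>- \<epsilon>\<close> at time 1 and makes its time derivative
    strictly positive at the minimum.\<close>
  define \<epsilon> where "\<epsilon> = - D 1 0 0 / 2"
  have "\<epsilon> > 0" using neg by (simp add: \<epsilon>_def)
  define E where "E = (\<lambda>(s, x, y). D s x y + \<epsilon> * s)"
  have E100: "E (1, 0, 0) = - \<epsilon>"
    by (simp add: E_def \<epsilon>_def)
  obtain Rf where Rf: "\<And>s x. 0 \<le> s \<Longrightarrow> s \<le> 1 \<Longrightarrow> Rf \<le> norm x \<Longrightarrow> log_heat f s x \<le> l + \<epsilon>"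
    using f.log_heat_at_infinity[OF \<open>\<epsilon> > 0\<close>] by blast
  obtain Rg where Rg: "\<And>s x. 0 \<le> s \<Longrightarrow> s \<le> 1 \<Longrightarrow> Rg \<le> norm x \<Longrightarrow> log_heat g s x \<le> l + \<epsilon>"
    using g.log_heat_at_infinity[OF \<open>\<epsilon> > 0\<close>] by blast
  have far: "E (s, x, y) > - \<epsilon>" if "0 \<le> s" "s \<le> 1" "Rf \<le> norm x \<or> Rg \<le> norm y" for s x y
  proof -
    have "log_heat f s x + log_heat g s y \<le> N + l + \<epsilon>"
      using Rf[OF that(1,2), of x] Rg[OF that(1,2), of y] that(3)
        f.log_heat_bounds(2)[of s x] g.log_heat_bounds(2)[of s y] by linarith
    moreover define q where "q = log_heat h s ((1 / 2) *\<^sub>R (x + y))"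
    moreover have "q \<ge> (N + l) / 2"
      unfolding q_def by (rule h.log_heat_bounds)
    ultimately have "D s x y \<ge> - \<epsilon> / 2"
      unfolding D_def q_def[symmetric] by (simp add: field_simps)
    moreover have "\<epsilon> * s \<ge> 0"
      using \<open>\<epsilon> > 0\<close> that by simp
    ultimately show ?thesis
      using \<open>\<epsilon> > 0\<close> by (simp add: E_def)
  qed
  define C where "C = {0..1::real} \<times> cball (0::'a) \<bar>Rf\<bar> \<times> cball (0::'a) \<bar>Rg\<bar>"
  have contE: "continuous_on ({0..1} \<times> UNIV) E"
  proof -
    have *: "continuous_on ({0..1} \<times> UNIV) (\<lambda>p. log_heat u (fst p) (k (snd p)))"
      if "heat_datum u m M" "continuous_on UNIV k" for u m M and k :: "'a \<times> 'a \<Rightarrow> 'a"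
      by (rule continuous_on_compose2[OF heat_datum.continuous_on_log_heat[OF that(1)],
            where f="\<lambda>p. (fst p, k (snd p))", simplified])
        (auto intro!: continuous_intros continuous_on_compose2[OF that(2)])
    show ?thesis
      unfolding E_def D_def case_prod_beta
      by (intro continuous_intros *[OF f] *[OF g] *[OF h]) auto
  qed
  have "compact C"
    unfolding C_def by (intro compact_Times compact_Icc compact_cball)
  moreover have "(1, 0, 0) \<in> C"
    by (simp add: C_def)
  moreover have "continuous_on C E"
    by (rule continuous_on_subset[OF contE]) (auto simp: C_def)
  ultimately obtain p where p: "p \<in> C" "\<And>q. q \<in> C \<Longrightarrow> E p \<le> E q"
    using continuous_attains_inf[of C E] by blast
  obtain s0 x0 y0 where p_eq: "p = (s0, x0, y0)"
    by (cases p)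
  have s0: "0 \<le> s0" "s0 \<le> 1"
    using p(1) by (auto simp: C_def p_eq)
  have Ep: "E p \<le> - \<epsilon>"
    using p(2)[OF \<open>(1, 0, 0) \<in> C\<close>] E100 by simp
  have Emin: "E (s0, x0, y0) \<le> E (s, x, y)" if "0 \<le> s" "s \<le> 1" for s x y
  proof (cases "(s, x, y) \<in> C")
    case True
    then show ?thesis using p(2) p_eq by simp
  next
    case False
    then have "Rf \<le> norm x \<or> Rg \<le> norm y"
      using that by (auto simp: C_def)
    then show ?thesis
      using far[OF that, of x y] Ep unfolding p_eq by linarith
  qed
  have "D 0 x0 y0 \<ge> 0"
    using init[of x0 y0] by (simp add: D_def log_heat_def)
  then have "s0 \<noteq> 0"
    using Ep \<open>\<epsilon> > 0\<close> by (auto simp: p_eq E_def)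
  with s0 have s0_pos: "s0 > 0" by simp
  have Dneg: "D s0 x0 y0 \<le> 0"
  proof -
    have "D s0 x0 y0 \<le> - \<epsilon> - \<epsilon> * s0"
      using Ep by (simp add: p_eq E_def)
    also have "\<dots> \<le> 0"
      using \<open>\<epsilon> > 0\<close> s0_pos mult_pos_pos[of \<epsilon> s0] by linarith
    finally show ?thesis .
  qed
  have Dmin: "D s0 x0 y0 \<le> D s0 x y" for x y
    using Emin[OF s0, of x y] by (simp add: E_def)
  obtain f1 f2 where
    f1: "\<And>e s x \<tau>. s > 0 \<Longrightarrow> norm e = 1 \<Longrightarrow>
       ((\<lambda>\<tau>. log_heat f s (x + \<tau> *\<^sub>R e)) has_real_derivative f1 e s (x + \<tau> *\<^sub>R e)) (at \<tau>)" and
    f2: "\<And>e s x \<tau>. s > 0 \<Longrightarrow> norm e = 1 \<Longrightarrow>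
       ((\<lambda>\<tau>. f1 e s (x + \<tau> *\<^sub>R e)) has_real_derivative f2 e s (x + \<tau> *\<^sub>R e)) (at \<tau>)" and
    ft: "\<And>s x. s > 0 \<Longrightarrow> ((\<lambda>s. log_heat f s x) has_real_derivative
       (\<Sum>e\<in>Basis. f2 e s x - log_heat f s x * (f1 e s x)\<^sup>2) / 2) (at s)"
    by (rule f.log_heat_has_derivatives) blast
  obtain g1 g2 where
    g1: "\<And>e s x \<tau>. s > 0 \<Longrightarrow> norm e = 1 \<Longrightarrow>
       ((\<lambda>\<tau>. log_heat g s (x + \<tau> *\<^sub>R e)) has_real_derivative g1 e s (x + \<tau> *\<^sub>R e)) (at \<tau>)" and
    g2: "\<And>e s x \<tau>. s > 0 \<Longrightarrow> norm e = 1 \<Longrightarrow>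
       ((\<lambda>\<tau>. g1 e s (x + \<tau> *\<^sub>R e)) has_real_derivative g2 e s (x + \<tau> *\<^sub>R e)) (at \<tau>)" and
    gt: "\<And>s x. s > 0 \<Longrightarrow> ((\<lambda>s. log_heat g s x) has_real_derivative
       (\<Sum>e\<in>Basis. g2 e s x - log_heat g s x * (g1 e s x)\<^sup>2) / 2) (at s)"
    by (rule g.log_heat_has_derivatives) blast
  obtain h1 h2 where
    h1: "\<And>e s x \<tau>. s > 0 \<Longrightarrow> norm e = 1 \<Longrightarrow>
       ((\<lambda>\<tau>. log_heat h s (x + \<tau> *\<^sub>R e)) has_real_derivative h1 e s (x + \<tau> *\<^sub>R e)) (at \<tau>)" and
    h2: "\<And>e s x \<tau>. s > 0 \<Longrightarrow> norm e = 1 \<Longrightarrow>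
       ((\<lambda>\<tau>. h1 e s (x + \<tau> *\<^sub>R e)) has_real_derivative h2 e s (x + \<tau> *\<^sub>R e)) (at \<tau>)" and
    ht: "\<And>s x. s > 0 \<Longrightarrow> ((\<lambda>s. log_heat h s x) has_real_derivative
       (\<Sum>e\<in>Basis. h2 e s x - log_heat h s x * (h1 e s x)\<^sup>2) / 2) (at s)"
    by (rule h.log_heat_has_derivatives) blast
  define z0 where "z0 = (1 / 2) *\<^sub>R (x0 + y0)"
  have mid: "(1 / 2) *\<^sub>R (x0 + \<tau> *\<^sub>R e + y0) = z0 + (\<tau> / 2) *\<^sub>R e"
    "(1 / 2) *\<^sub>R (x0 + (y0 + \<tau> *\<^sub>R e)) = z0 + (\<tau> / 2) *\<^sub>R e"
    "(1 / 2) *\<^sub>R (x0 + \<tau> *\<^sub>R e + (y0 + \<tau> *\<^sub>R e)) = z0 + \<tau> *\<^sub>R e" for \<tau> and e :: 'a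
    by (simp_all add: z0_def algebra_simps flip: scaleR_add_left)
  have half: "((\<lambda>\<tau>. log_heat h s0 (z0 + (\<tau> / 2) *\<^sub>R e)) has_real_derivative h1 e s0 z0 / 2) (at 0)"
    if "norm e = 1" for e
  proof -
    have "((\<lambda>\<tau>::real. \<tau> / 2) has_real_derivative 1 / 2) (at 0)"
      by (auto intro!: derivative_eq_intros)
    from DERIV_chain2[of "\<lambda>\<tau>. log_heat h s0 (z0 + \<tau> *\<^sub>R e)", OF _ this] h1[OF s0_pos that, of z0 0]
    show ?thesis by simp
  qed
  \<comment> \<open>When one point moves alone, the midpoint moves at half speed. This matches the
    factor 1/2 before the term of f, so the gradients at the minimum agree exactly.\<close>
  have grad_f: "f1 e s0 x0 = h1 e s0 z0" if e: "norm e = 1" for e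
  proof -
    have "((\<lambda>\<tau>. D s0 (x0 + \<tau> *\<^sub>R e) y0) has_real_derivative h1 e s0 z0 / 2 - f1 e s0 x0 / 2) (at 0)"
      unfolding D_def mid using half[OF e] f1[OF s0_pos e, of x0 0]
      by (auto intro!: derivative_eq_intros)
    from DERIV_local_min[OF this, of 1] Dmin show ?thesis by simp
  qed
  have grad_g: "g1 e s0 y0 = h1 e s0 z0" if e: "norm e = 1" for e
  proof -
    have "((\<lambda>\<tau>. D s0 x0 (y0 + \<tau> *\<^sub>R e)) has_real_derivative h1 e s0 z0 / 2 - g1 e s0 y0 / 2) (at 0)"
      unfolding D_def mid using half[OF e] g1[OF s0_pos e, of y0 0]
      by (auto intro!: derivative_eq_intros)
    from DERIV_local_min[OF this, of 1] Dmin show ?thesis by simp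
  qed
  \<comment> \<open>Both points move together and the midpoint at full speed. In this direction the
    second derivatives carry the weights 1, 1/2, 1/2 with which they enter the time derivative of
    \<open>D\<close>.\<close>
  have hess: "0 \<le> h2 e s0 z0 - f2 e s0 x0 / 2 - g2 e s0 y0 / 2" if e: "norm e = 1" for e
  proof (rule second_derivative_nonneg_at_minimum)
    show "((\<lambda>\<tau>. D s0 (x0 + \<tau> *\<^sub>R e) (y0 + \<tau> *\<^sub>R e)) has_real_derivative
        h1 e s0 (z0 + \<tau> *\<^sub>R e) - f1 e s0 (x0 + \<tau> *\<^sub>R e) / 2 - g1 e s0 (y0 + \<tau> *\<^sub>R e) / 2) (at \<tau>)" for \<tau>
      unfolding D_def mid
      by (intro derivative_intros DERIV_cdivide h1[OF s0_pos e] f1[OF s0_pos e] g1[OF s0_pos e])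
    show "((\<lambda>\<tau>. h1 e s0 (z0 + \<tau> *\<^sub>R e) - f1 e s0 (x0 + \<tau> *\<^sub>R e) / 2 - g1 e s0 (y0 + \<tau> *\<^sub>R e) / 2)
        has_real_derivative h2 e s0 z0 - f2 e s0 x0 / 2 - g2 e s0 y0 / 2) (at 0)"
      using h2[OF s0_pos e, of z0 0] f2[OF s0_pos e, of x0 0] g2[OF s0_pos e, of y0 0]
      by (intro derivative_intros DERIV_cdivide) simp_all
    show "D s0 (x0 + 0 *\<^sub>R e) (y0 + 0 *\<^sub>R e) \<le> D s0 (x0 + \<tau> *\<^sub>R e) (y0 + \<tau> *\<^sub>R e)" for \<tau>
      using Dmin by simp
  qed
  define Dt where "Dt = (\<Sum>e\<in>Basis. h2 e s0 z0 - log_heat h s0 z0 * (h1 e s0 z0)\<^sup>2) / 2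
    - (\<Sum>e\<in>Basis. f2 e s0 x0 - log_heat f s0 x0 * (f1 e s0 x0)\<^sup>2) / 2 / 2
    - (\<Sum>e\<in>Basis. g2 e s0 y0 - log_heat g s0 y0 * (g1 e s0 y0)\<^sup>2) / 2 / 2"
  \<comment> \<open>Since the gradients agree, the nonlinear terms combine to a multiple of
    \<open>D\<close> itself, whose sign is favourable because \<open>D\<close> is nonpositive at the
    minimum.\<close>
  have "Dt = (\<Sum>e\<in>Basis. (h2 e s0 z0 - f2 e s0 x0 / 2 - g2 e s0 y0 / 2) - (h1 e s0 z0)\<^sup>2 * D s0 x0 y0) / 2"
    unfolding Dt_def sum_divide_distrib sum_subtractf[symmetric] D_def z0_def[symmetric]
    by (intro sum.cong refl) (simp add: grad_f grad_g field_simps)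
  also have "\<dots> \<ge> 0"
    using Dneg by (intro divide_nonneg_pos sum_nonneg) (auto simp: hess mult_nonneg_nonpos intro: order_trans[OF _ hess])
  finally have "Dt + \<epsilon> > 0"
    using \<open>\<epsilon> > 0\<close> by simp
  moreover have "((\<lambda>s. E (s, x0, y0)) has_real_derivative Dt + \<epsilon>) (at s0)"
    unfolding E_def D_def Dt_def prod.case z0_def[symmetric]
    by (rule DERIV_cong, (rule derivative_intros DERIV_cdivide ft[OF s0_pos] gt[OF s0_pos] ht[OF s0_pos])+) simp
  ultimately obtain d where d: "d > 0" "\<And>t. 0 < t \<Longrightarrow> t < d \<Longrightarrow> E (s0 - t, x0, y0) < E (s0, x0, y0)"
    using DERIV_pos_inc_left by blast
  \<comment> \<open>The contradiction uses earlier times only, since \<open>s0\<close> may be 1; a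
    step back of at most \<open>s0 / 2\<close> stays in the unit interval.\<close>
  have "E (s0 - min d s0 / 2, x0, y0) < E (s0, x0, y0)"
    using d(1) s0_pos by (intro d(2)) auto
  moreover have "E (s0, x0, y0) \<le> E (s0 - min d s0 / 2, x0, y0)"
    using d(1) s0_pos s0 by (intro Emin) auto
  ultimately show False by simp
qed

section \<open>Ehrhard's inequality: from functions to sets\<close>

definition is_cutoff :: "('a::euclidean_space \<Rightarrow> real) \<Rightarrow> 'a set \<Rightarrow> 'a set \<Rightarrow> bool" where
  "is_cutoff \<eta> C S \<longleftrightarrow> continuous_on UNIV \<eta> \<and> (\<forall>x. 0 \<le> \<eta> x \<and> \<eta> x \<le> 1) \<and> (\<forall>x\<in>C. \<eta> x = 1) \<and>
     compact S \<and> C \<subseteq> S \<and> (\<forall>x. x \<notin> S \<longrightarrow> \<eta> x = 0)"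

lemma is_cutoffD:
  assumes "is_cutoff \<eta> C S"
  shows "continuous_on UNIV \<eta>" "0 \<le> \<eta> x" "\<eta> x \<le> 1" "x \<in> C \<Longrightarrow> \<eta> x = 1"
    "compact S" "C \<subseteq> S" "x \<notin> S \<Longrightarrow> \<eta> x = 0"
  using assms by (auto simp: is_cutoff_def)

lemma compact_cutoff:
  fixes C U :: "'a::euclidean_space set"
  assumes "compact C" "C \<noteq> {}" "open U" "C \<subseteq> U"
  obtains \<eta> S where "is_cutoff \<eta> C S" "S \<subseteq> U"
proof -
  obtain \<epsilon> where \<epsilon>: "\<epsilon> > 0" "{x. infdist x C \<le> \<epsilon>} \<subseteq> U"
    using compact_in_open_separated[OF assms(2,1,3,4)] by blast
  have "continuous_on UNIV (\<lambda>x. max 0 (1 - infdist x C / \<epsilon>))"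
    using \<epsilon>(1) by (intro continuous_intros) auto
  moreover have "compact {x. infdist x C \<le> \<epsilon>}"
    using compact_infdist_le[OF assms(2,1) \<epsilon>(1)] .
  ultimately have "is_cutoff (\<lambda>x. max 0 (1 - infdist x C / \<epsilon>)) C {x. infdist x C \<le> \<epsilon>}"
    using \<epsilon>(1) infdist_nonneg[of _ C] by (auto simp: is_cutoff_def field_simps)
  then show thesis
    using \<epsilon>(2) by (rule that)
qed

text \<open>The gap between a and b pays for two losses: passing to a compact subset, and the factor
  \<open>Phi M\<close>, which is there because the datum replacing the indicator of C has the value
  \<open>Phi M\<close> instead of 1 on C.\<close>

lemma compact_inner_approximation:
  fixes A :: "'a::euclidean_space set"
  assumes "open A" "a < b" "Phi b \<le> measure gaussian_measure A"
  obtains C N where "compact C" "C \<noteq> {}" "C \<subseteq> A"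
    "\<And>M. N \<le> M \<Longrightarrow> Phi a \<le> Phi M * measure gaussian_measure C"
proof -
  have [measurable]: "A \<in> sets borel" using assms by simp
  have "emeasure gaussian_measure A = (SUP C\<in>{C. C \<subseteq> A \<and> compact C}. emeasure gaussian_measure C)"
    by (rule inner_regular) auto
  moreover have "ennreal (Phi ((a + b) / 2)) < emeasure gaussian_measure A"
  proof -
    have "Phi ((a + b) / 2) < measure gaussian_measure A"
      using assms(2,3) by (intro less_le_trans[OF _ assms(3)]) auto
    then show ?thesis
      by (simp add: gauss.emeasure_eq_measure ennreal_less_iff less_imp_le)
  qed
  ultimately obtain C where C: "C \<subseteq> A" "compact C" "ennreal (Phi ((a + b) / 2)) < emeasure gaussian_measure C"
    by (auto simp: less_SUP_iff)
  then have mC: "Phi ((a + b) / 2) < measure gaussian_measure C"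
    by (simp add: gauss.emeasure_eq_measure ennreal_less_iff less_imp_le)
  have "((\<lambda>M. Phi M * measure gaussian_measure C) \<longlongrightarrow> 1 * measure gaussian_measure C) at_top"
    by (intro tendsto_intros Phi_at_top)
  moreover have "Phi a < 1 * measure gaussian_measure C"
    using mC assms(2) by (simp add: less_trans[OF _ mC])
  ultimately have "eventually (\<lambda>M. Phi a < Phi M * measure gaussian_measure C) at_top"
    by (rule order_tendstoD)
  then obtain N where "\<And>M. N \<le> M \<Longrightarrow> Phi a < Phi M * measure gaussian_measure C"
    by (auto simp: eventually_at_top_linorder)
  moreover have "C \<noteq> {}"
    using less_trans[OF Phi_pos mC] by auto
  ultimately show thesis
    using that[of C N] C by (auto intro: less_imp_le)
qed

lemma heat_datum_cutoff:
  assumes "is_cutoff \<eta> C S" "m \<le> N"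
  shows "heat_datum (\<lambda>x. Phi m + (Phi N - Phi m) * \<eta> x) m N"
proof
  obtain r where r: "\<And>x. x \<in> S \<Longrightarrow> norm x < r"
    using compact_imp_bounded[OF is_cutoffD(5)[OF assms(1)]] by (auto simp: bounded_pos_less)
  show "\<exists>r. \<forall>x. r \<le> norm x \<longrightarrow> Phi m + (Phi N - Phi m) * \<eta> x = Phi m"
    using r is_cutoffD(7)[OF assms(1)] by (intro exI[of _ r]) fastforce
  show "Phi m + (Phi N - Phi m) * \<eta> x \<le> Phi N" for x
    using mult_left_mono[OF is_cutoffD(3)[OF assms(1), of x], of "Phi N - Phi m"] assms(2) by simp
qed (use assms is_cutoffD[OF assms(1)] in \<open>auto intro!: continuous_intros\<close>)

text \<open>At time 1 and the origin, the flows of the two lower data are at least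
  \<open>Phi N\<close> times the measures of C and C', while that of the third exceeds the measure
  of M by at most its floor \<open>Phi ((N + l) / 2)\<close>. With N fixed, this error vanishes as l
  tends to minus infinity.\<close>

lemma ehrhard_midpoint_compact:
  fixes C C' M :: "'a::euclidean_space set"
  assumes "compact C" "C \<noteq> {}" "open A" "C \<subseteq> A" and "compact C'" "C' \<noteq> {}" "open B" "C' \<subseteq> B"
    and "open M" and AB: "\<And>x y. x \<in> A \<Longrightarrow> y \<in> B \<Longrightarrow> (1 / 2) *\<^sub>R (x + y) \<in> M"
    and a: "Phi a \<le> Phi N * measure gaussian_measure C" and b: "Phi b \<le> Phi N * measure gaussian_measure C'"
  shows "Phi ((a + b) / 2) \<le> measure gaussian_measure M"
proof -
  obtain \<eta>A SA where \<eta>A: "is_cutoff \<eta>A C SA" "SA \<subseteq> A"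
    using compact_cutoff[OF assms(1-4)] .
  obtain \<eta>B SB where \<eta>B: "is_cutoff \<eta>B C' SB" "SB \<subseteq> B"
    using compact_cutoff[OF assms(5-8)] .
  \<comment> \<open>Midpoints of the supports and not merely of C and C', because f and g may exceed
    their floor anywhere on the supports.\<close>
  define T where "T = (\<lambda>p. (1 / 2) *\<^sub>R (fst p + snd p)) ` (SA \<times> SB)"
  have "compact T"
    unfolding T_def by (intro compact_continuous_image compact_Times continuous_intros
        is_cutoffD(5)[OF \<eta>A(1)] is_cutoffD(5)[OF \<eta>B(1)])
  moreover have "T \<noteq> {}"
    using assms(2,6) is_cutoffD(6)[OF \<eta>A(1)] is_cutoffD(6)[OF \<eta>B(1)] by (auto simp: T_def)
  moreover have "T \<subseteq> M"
    using \<eta>A(2) \<eta>B(2) by (auto simp: T_def intro!: AB)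
  ultimately obtain \<eta>M SM where \<eta>M: "is_cutoff \<eta>M T SM" "SM \<subseteq> M"
    using compact_cutoff[OF _ _ \<open>open M\<close>, of T] by blast
  have bound: "Phi ((a + b) / 2) \<le> Phi ((N + l) / 2) + measure gaussian_measure M" if "l \<le> N" for l
  proof -
    define m where "m = (N + l) / 2"
    have m: "l \<le> m" "m \<le> N" using that by (auto simp: m_def)
    define f where "f x = Phi l + (Phi N - Phi l) * \<eta>A x" for x
    define g where "g x = Phi l + (Phi N - Phi l) * \<eta>B x" for x
    define h where "h x = Phi m + (Phi N - Phi m) * \<eta>M x" for x
    interpret f: heat_datum f l N
      unfolding f_def[abs_def] by (rule heat_datum_cutoff[OF \<eta>A(1) that])
    interpret g: heat_datum g l N
      unfolding g_def[abs_def] by (rule heat_datum_cutoff[OF \<eta>B(1) that])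
    interpret h: heat_datum h m N
      unfolding h_def[abs_def] by (rule heat_datum_cutoff[OF \<eta>M(1) m(2)])
    have inv_bounds: "l \<le> Phi_inv (f x)" "Phi_inv (f x) \<le> N" "l \<le> Phi_inv (g x)" "Phi_inv (g x) \<le> N"
      "m \<le> Phi_inv (h x)" for x
      using f.log_heat_bounds[of 0 x] g.log_heat_bounds[of 0 x] h.log_heat_bounds[of 0 x]
      by (auto simp: log_heat_def)
    \<comment> \<open>Either h has its maximal value \<open>Phi N\<close> at the midpoint, or one of
      f, g is at its floor and the average is at most m, the floor of h.\<close>
    have init: "(Phi_inv (f x) + Phi_inv (g y)) / 2 \<le> Phi_inv (h ((1 / 2) *\<^sub>R (x + y)))" for x y
    proof (cases "x \<in> SA \<and> y \<in> SB")
      case True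
      then have "(1 / 2) *\<^sub>R (x + y) \<in> T"
        unfolding T_def by (intro image_eqI[of _ _ "(x, y)"]) auto
      then have "h ((1 / 2) *\<^sub>R (x + y)) = Phi N"
        using is_cutoffD(4)[OF \<eta>M(1)] by (simp add: h_def)
      then show ?thesis
        using inv_bounds(2)[of x] inv_bounds(4)[of y] by simp
    next
      case False
      then have "f x = Phi l \<or> g y = Phi l"
        using is_cutoffD(7)[OF \<eta>A(1)] is_cutoffD(7)[OF \<eta>B(1)] by (auto simp: f_def g_def)
      then have "(Phi_inv (f x) + Phi_inv (g y)) / 2 \<le> m"
        using inv_bounds(2)[of x] inv_bounds(4)[of y] by (auto simp: m_def)
      then show ?thesis
        using inv_bounds(5) by (rule order_trans)
    qed
    have low: "Phi c \<le> heat u 1 0"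
      if "Phi c \<le> Phi N * measure gaussian_measure K" "compact K" "heat_datum u l N" "\<And>x. x \<in> K \<Longrightarrow> u x = Phi N"
      for c u and K :: "'a set"
    proof -
      interpret u: heat_datum u l N by fact
      have "Phi c \<le> (\<integral>z. Phi N * indicator K z \<partial>gaussian_measure)"
        using that(1,2) by (simp add: borel_compact)
      also have "\<dots> \<le> heat u 1 0"
        unfolding heat_def
      proof (rule integral_mono)
        have [measurable]: "K \<in> sets borel"
          using that(2) by (rule borel_compact)
        show "integrable gaussian_measure (\<lambda>z. Phi N * indicator K z)"
          by (rule integrable_gaussian_bounded[where B="Phi N"]) (auto simp: indicator_def less_imp_le)
        show "integrable gaussian_measure (\<lambda>z. u (0 + sqrt 1 *\<^sub>R z))"
          by (rule integrable_heat[OF u.continuous u.lower u.upper])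
        show "Phi N * indicator K z \<le> u (0 + sqrt 1 *\<^sub>R z)" for z
          using that(4) less_imp_le[OF less_le_trans[OF Phi_pos u.lower[of z]]] by (auto simp: indicator_def)
      qed
      finally show ?thesis .
    qed
    have "a \<le> log_heat f 1 0" "b \<le> log_heat g 1 0"
      using low[OF a assms(1) f.heat_datum_axioms] low[OF b assms(5) g.heat_datum_axioms]
        is_cutoffD(4)[OF \<eta>A(1)] is_cutoffD(4)[OF \<eta>B(1)]
      by (auto simp: log_heat_def le_Phi_inv_iff f.heat_in_range g.heat_in_range f_def g_def)
    then have "(a + b) / 2 \<le> log_heat h 1 0"
      using log_heat_midpoint[OF f.heat_datum_axioms g.heat_datum_axioms _ init]
        h.heat_datum_axioms by (simp add: m_def)
    then have *: "Phi ((a + b) / 2) \<le> heat h 1 0"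
      unfolding log_heat_def le_Phi_inv_iff[OF h.heat_in_range] .
    have indM: "integrable gaussian_measure (indicator M :: 'a \<Rightarrow> real)"
      using \<open>open M\<close> by (simp add: gauss.emeasure_eq_measure)
    note *
    also have "heat h 1 0 \<le> (\<integral>z. Phi m + indicator M z \<partial>gaussian_measure)"
      unfolding heat_def
    proof (intro integral_mono integrable_heat[OF h.continuous h.lower h.upper])
      show "integrable gaussian_measure (\<lambda>z. Phi m + indicator M z)"
        using indM by simp
      fix z
      have "h z \<le> Phi m + indicator M z"
      proof (cases "z \<in> SM")
        case True
        then have "h z \<le> 1" "z \<in> M"
          using order_trans[OF h.upper[of z] less_imp_le[OF Phi_less_1]] \<eta>M(2) by auto
        then show ?thesis
          by (simp add: add_increasing less_imp_le)
      qed (use is_cutoffD(7)[OF \<eta>M(1)] in \<open>simp add: h_def\<close>)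
      then show "h (0 + sqrt 1 *\<^sub>R z) \<le> Phi m + indicator M z" by simp
    qed
    also have "\<dots> = Phi m + measure gaussian_measure M"
      using indM \<open>open M\<close> by (subst Bochner_Integration.integral_add) auto
    finally show ?thesis by (simp add: m_def)
  qed
  have "((\<lambda>l. Phi ((N + l) / 2) + measure gaussian_measure M) \<longlongrightarrow> 0 + measure gaussian_measure M) at_bot"
    by (rule tendsto_add[OF filterlim_compose[OF Phi_at_bot] tendsto_const]) real_asymp
  then show ?thesis
    using bound by (intro tendsto_lowerbound[of _ "measure gaussian_measure M" at_bot "Phi ((a + b) / 2)"])
      (auto simp: eventually_at_bot_linorder intro!: exI[of _ N])
qed

text \<open>Quantifying over a and b avoids \<open>Phi_inv\<close> of a measure, so that sets of
  measure 0 or 1 need no separate treatment. The loss \<delta> of the compact approximation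
  disappears by continuity of \<open>Phi\<close>.\<close>

theorem ehrhard_midpoint:
  fixes A B M :: "'a::euclidean_space set"
  assumes "open A" "open B" "open M"
    and AB: "\<And>x y. x \<in> A \<Longrightarrow> y \<in> B \<Longrightarrow> (1 / 2) *\<^sub>R (x + y) \<in> M"
    and a: "Phi a \<le> measure gaussian_measure A" and b: "Phi b \<le> measure gaussian_measure B"
  shows "Phi ((a + b) / 2) \<le> measure gaussian_measure M"
proof -
  have *: "Phi ((a + b) / 2 - \<delta>) \<le> measure gaussian_measure M" if "\<delta> > 0" for \<delta>
  proof -
    have \<delta>: "a - \<delta> < a" "b - \<delta> < b" using that by auto
    obtain C N where C: "compact C" "C \<noteq> {}" "C \<subseteq> A"
      "\<And>M. N \<le> M \<Longrightarrow> Phi (a - \<delta>) \<le> Phi M * measure gaussian_measure C"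
      by (rule compact_inner_approximation[OF \<open>open A\<close> \<delta>(1) a]) (rule that; assumption)
    obtain C' N' where C': "compact C'" "C' \<noteq> {}" "C' \<subseteq> B"
      "\<And>M. N' \<le> M \<Longrightarrow> Phi (b - \<delta>) \<le> Phi M * measure gaussian_measure C'"
      by (rule compact_inner_approximation[OF \<open>open B\<close> \<delta>(2) b]) (rule that; assumption)
    have "Phi (((a - \<delta>) + (b - \<delta>)) / 2) \<le> measure gaussian_measure M"
      by (rule ehrhard_midpoint_compact[OF C(1,2) \<open>open A\<close> C(3) C'(1,2) \<open>open B\<close> C'(3) \<open>open M\<close> AB
            C(4)[of "max N N'"] C'(4)[of "max N N'"]]) auto
    moreover have "((a - \<delta>) + (b - \<delta>)) / 2 = (a + b) / 2 - \<delta>"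
      by (simp add: field_simps)
    ultimately show ?thesis by (simp only:)
  qed
  define c where "c = (a + b) / 2"
  have "(Phi \<longlongrightarrow> Phi c) (at_left c)"
    using isCont_Phi[of c] by (auto simp: isCont_def intro: tendsto_within_subset)
  moreover have "eventually (\<lambda>t. Phi t \<le> measure gaussian_measure M) (at_left c)"
    unfolding eventually_at_left_field
    using *[of "c - t" for t] by (intro exI[of _ "c - 1"]) (auto simp flip: c_def)
  ultimately show ?thesis
    unfolding c_def[symmetric] by (intro tendsto_upperbound[of Phi]) auto
qed

section \<open>Averages of a decreasing function\<close>

lemma Psi_eq: "x \<ge> 0 \<Longrightarrow> Psi x = 2 * Phi x - 1"
  using Phi_diff_eq_integral[of "- x" x] by (simp add: Psi_def measure_gaussian_Icc Phi_minus)

lemma measure_gaussian_eq_integral: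
  assumes "A \<in> sets borel"
  shows "integrable lborel (\<lambda>t. indicator A t * gaussian_density t :: real)"
    and "measure gaussian_measure (A :: 'a::euclidean_space set) = (\<integral>t. indicator A t * gaussian_density t \<partial>lborel)"
proof -
  have fin: "(\<integral>\<^sup>+t. ennreal (indicator A t * gaussian_density t) \<partial>lborel) = emeasure gaussian_measure A"
    using assms by (auto simp: emeasure_gaussian_measure indicator_def intro!: nn_integral_cong)
  show "integrable lborel (\<lambda>t. indicator A t * gaussian_density t :: real)"
    using assms by (intro integrableI_nonneg) (auto simp: fin gauss.emeasure_eq_measure)
  show "measure gaussian_measure A = (\<integral>t. indicator A t * gaussian_density t \<partial>lborel)"
    using assms by (subst integral_eq_nn_integral) (auto simp: fin measure_def)
qed

text \<open>The extremal case of the hypothesis is \<open>r1 = Phi (\<alpha> + s)\<close>, \<open>r2 = Phi (\<alpha> - s)\<close> where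
  \<open>p = Phi \<alpha>\<close>; the bound is then the log-concavity of \<open>Phi\<close>.\<close>

lemma midpoint_concave_pair:
  assumes p: "0 < p" "p \<le> 1 / 2" and r: "r1 \<le> 1" "0 \<le> r2" "r2 \<le> p"
    and mid: "\<And>a b. Phi a \<le> r1 \<Longrightarrow> Phi b \<le> r2 \<Longrightarrow> Phi ((a + b) / 2) \<le> p"
  shows "p * r1 + (1 - p) * r2 \<le> p"
proof (rule ccontr)
  assume contra: "\<not> ?thesis"
  obtain \<alpha> where \<alpha>: "Phi \<alpha> = p"
    using Phi_surj[of p] p by auto
  have "\<alpha> \<le> 0"
    using p \<alpha> Phi_le_iff[of \<alpha> 0] by (simp add: Phi_0)
  \<comment> \<open>The value of \<open>r1\<close> at which the claimed inequality would be an
    equality.\<close>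
  define q where "q = 1 - (1 - p) * r2 / p"
  have pq: "p * q = p - (1 - p) * r2"
    using p by (simp add: q_def field_simps)
  have "q < r1"
  proof -
    have "p * q < p * r1" using contra pq by simp
    then show ?thesis using p by simp
  qed
  have "p < r1"
  proof (rule ccontr)
    assume "\<not> p < r1"
    then have "p * r1 + (1 - p) * r2 \<le> p * p + (1 - p) * p"
      using p r by (intro add_mono mult_left_mono) auto
    then show False using contra by (simp add: algebra_simps)
  qed
  with \<open>q < r1\<close> have "max q p < r1" by simp
  \<comment> \<open>\<open>r1\<close> may be 1, a value that \<open>Phi\<close> never takes; r is
    slightly smaller and still exceeds q.\<close>
  then obtain r where r': "max q p < r" "r < r1"
    using dense[of "max q p" r1] by blast
  then obtain t where t: "Phi t = r"
    using Phi_surj[of r] p r by auto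
  define s where "s = t - \<alpha>"
  have s: "Phi (\<alpha> + s) = r" "s \<ge> 0"
    using r' t \<alpha> Phi_le_iff[of \<alpha> t] by (auto simp: s_def)
  \<comment> \<open>Otherwise some \<open>b > \<alpha> - s\<close> would be admissible, and its
    midpoint with \<open>\<alpha> + s\<close> would lie beyond \<alpha>.\<close>
  have "r2 \<le> Phi (\<alpha> - s)"
  proof (rule ccontr)
    assume "\<not> ?thesis"
    then obtain r'' where r'': "Phi (\<alpha> - s) < r''" "r'' < r2"
      using dense[of "Phi (\<alpha> - s)" r2] by (auto simp: not_le)
    then have "0 < r''" "r'' < 1"
      using Phi_pos[of "\<alpha> - s"] r p by linarith+
    then obtain b where b: "Phi b = r''"
      using Phi_surj by blast
    have "Phi ((\<alpha> + s + b) / 2) \<le> Phi \<alpha>"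
      using mid[of "\<alpha> + s" b] r' r'' s b \<alpha> by simp
    moreover have "\<alpha> - s < b"
      using r'' b Phi_less_iff by blast
    ultimately show False by simp
  qed
  then have "(1 - p) * r2 \<le> Phi (\<alpha> - s) * Phi (- \<alpha>)"
    using p by (simp add: Phi_minus \<alpha> mult.commute)
  \<comment> \<open>Here \<open>p \<le> 1 / 2\<close> is used: log-concavity compares \<alpha> with
    \<open>- \<alpha>\<close>, which must not be smaller.\<close>
  also have "\<dots> \<le> Phi (- \<alpha> - s) * Phi \<alpha>"
    using Phi_shift_ratio[of \<alpha> "- \<alpha>" s] \<open>\<alpha> \<le> 0\<close> s by simp
  also have "Phi (- \<alpha> - s) = 1 - r"
    using Phi_minus[of "\<alpha> + s"] s by simp
  also have "(1 - r) * Phi \<alpha> < (1 - q) * p"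
    unfolding \<alpha> using r' p by (intro mult_strict_right_mono) auto
  also have "\<dots> = (1 - p) * r2"
    using pq by (simp add: algebra_simps)
  finally show False by simp
qed

lemma gaussian_density_antimono:
  fixes s t :: real
  assumes "0 \<le> s" "s \<le> t"
  shows "gaussian_density t \<le> gaussian_density s"
  using power_mono[OF assms(2,1), of 2] unfolding gaussian_density_def
  by (intro mult_left_mono) auto

lemma even_integral_halves:
  fixes g :: "real \<Rightarrow> real"
  assumes "integrable lborel g" "\<And>t. g (- t) = g t"
  shows "(\<integral>t. g t \<partial>lborel) = 2 * (\<integral>t. indicator {0..} t * g t \<partial>lborel)"
proof -
  have int: "integrable lborel (\<lambda>t. indicator A t * g t)" if "A \<in> sets borel" for A
    using integrable_mult_indicator[of A lborel g] assms(1) that by simp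
  have "(\<integral>t. indicator {..0} t * g t \<partial>lborel) = (\<integral>t. indicator {..0} (- t) * g (- t) \<partial>lborel)"
    using lborel_integral_real_affine[of "-1" "\<lambda>t. indicator {..0} t * g t" 0] by simp
  also have "\<dots> = (\<integral>t. indicator {0..} t * g t \<partial>lborel)"
    by (intro Bochner_Integration.integral_cong) (auto simp: assms(2) indicator_def)
  finally have refl: "(\<integral>t. indicator {..0} t * g t \<partial>lborel) = (\<integral>t. indicator {0..} t * g t \<partial>lborel)" .
  have "(\<integral>t. g t \<partial>lborel) = (\<integral>t. indicator {..0} t * g t + indicator {0..} t * g t \<partial>lborel)"
    using assms(1) int
    by (intro integral_cong_AE) (auto intro!: borel_measurable_add borel_measurable_integrable
        eventually_mono[OF AE_lborel_singleton[of 0]] simp: indicator_def)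
  also have "\<dots> = (\<integral>t. indicator {..0} t * g t \<partial>lborel) + (\<integral>t. indicator {0..} t * g t \<partial>lborel)"
    by (intro Bochner_Integration.integral_add int) auto
  finally show ?thesis using refl by simp
qed

text \<open>Conditionally on \<open>|z| > w\<close>, the excess \<open>|z| - w\<close> stochastically dominates the defect \<open>w - |z|\<close>
  conditioned on \<open>|z| \<le> w\<close>; the hypothesis \<open>pair\<close> is then averaged over the latter.\<close>

lemma gaussian_average_le:
  fixes F :: "real \<Rightarrow> real"
  assumes [measurable]: "F \<in> borel_measurable borel" and even: "\<And>t. F (- t) = F t"
    and anti: "\<And>s t. 0 \<le> s \<Longrightarrow> s \<le> t \<Longrightarrow> F t \<le> F s" and F01: "\<And>t. 0 \<le> F t" "\<And>t. F t \<le> 1"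
    and w: "0 < w" and p: "p = Psi w" "p \<le> 1 / 2"
    and pair: "\<And>\<delta>. 0 \<le> \<delta> \<Longrightarrow> \<delta> \<le> w \<Longrightarrow> p * F (w - \<delta>) + (1 - p) * F (w + \<delta>) \<le> p"
  shows "(\<integral>t. F t \<partial>gaussian_measure) \<le> p"
proof -
  \<comment> \<open>The odds against \<open>|z| \<le> w\<close>. Divided by p, the hypothesis
    \<open>pair\<close> reads \<open>F t + c * F (2 * w - t) \<le> 1\<close>.\<close>
  define c where "c = (1 - p) / p"
  have Pw: "Phi w = (1 + p) / 2"
    using Psi_eq[of w] w p by simp
  have "p > 0"
    using Pw Phi_less_iff[of 0 w] w by (simp add: Phi_0)
  have "c \<ge> 1"
    using p \<open>p > 0\<close> by (simp add: c_def)
  have cp: "c * p = 1 - p"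
    using \<open>p > 0\<close> by (simp add: c_def)
  let ?\<phi> = "gaussian_density :: real \<Rightarrow> real"
  have meas_Ioc: "measure gaussian_measure {a<..b} = Phi b - Phi a" if "a \<le> b" for a b :: real
  proof -
    have "measure gaussian_measure ({..a} \<union> {a<..b})
        = measure gaussian_measure {..a} + measure gaussian_measure {a<..b}"
      by (rule gauss.finite_measure_Union) auto
    moreover have "{..a} \<union> {a<..b} = {..b}" using that by auto
    ultimately show ?thesis
      unfolding Phi_def by simp
  qed
  have meas_Ico: "measure gaussian_measure {a..<b} = Phi b - Phi a" if "a < b" for a b :: real
  proof -
    have "measure gaussian_measure {a<..b} = measure gaussian_measure ({a<..<b} \<union> {b})"
      using that by (intro arg_cong[where f="measure _"]) auto
    also have "\<dots> = measure gaussian_measure {a<..<b} + measure gaussian_measure {b}"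
      by (rule gauss.finite_measure_Union) auto
    also have "\<dots> = measure gaussian_measure {a<..<b} + measure gaussian_measure {a}"
      by simp
    also have "\<dots> = measure gaussian_measure ({a<..<b} \<union> {a})"
      by (rule gauss.finite_measure_Union[symmetric]) auto
    also have "{a<..<b} \<union> {a} = {a..<b}"
      using that by auto
    finally show ?thesis
      using meas_Ioc[of a b] that by simp
  qed
  have meas_Ioi: "measure gaussian_measure {a<..} = 1 - Phi a" for a :: real
    unfolding Phi_def by (subst gauss.prob_compl[symmetric]) (auto intro!: arg_cong[where f="measure _"])
  define g where "g t = F t * ?\<phi> t" for t
  have int_dens: "integrable lborel ?\<phi>"
    using measure_gaussian_eq_integral(1)[of "UNIV::real set"] by simp
  have int_bd: "integrable lborel (\<lambda>t. u t * ?\<phi> t)" if "u \<in> borel_measurable borel" "\<And>t. \<bar>u t\<bar> \<le> 1" for u :: "real \<Rightarrow> real"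
    using int_dens that by (rule_tac Bochner_Integration.integrable_bound[OF int_dens])
      (auto simp: abs_mult intro!: mult_left_le_one_le)
  have "(\<integral>t. F t \<partial>gaussian_measure) = (\<integral>t. g t \<partial>lborel)"
    unfolding gaussian_measure_eq_density g_def
    by (subst integral_density) (auto simp: mult.commute)
  also have "\<dots> = 2 * (\<integral>t. indicator {0..} t * g t \<partial>lborel)"
    using F01 by (intro even_integral_halves) (auto simp: g_def even intro!: int_bd abs_leI order_trans[OF _ F01(1)])
  also have "(\<integral>t. indicator {0..} t * g t \<partial>lborel) \<le> p / 2"
  proof -
    let ?I = "{0..<w}"
    have int0: "integrable lborel (\<lambda>t. indicator A t * g t)" if [measurable]: "A \<in> sets borel" for A
      using F01 unfolding g_def mult.assoc[symmetric]
      by (intro int_bd) (auto simp: indicator_def intro!: abs_leI order_trans[OF _ F01(1)])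
    \<comment> \<open>The reflection t to \<open>2 * w - t\<close> pairs the first two ranges.
      Points beyond \<open>2 * w\<close> have no partner; there F is bounded by
      \<open>F (2 * w)\<close>.\<close>
    have split: "(\<integral>t. indicator {0..} t * g t \<partial>lborel) = (\<integral>t. indicator ?I t * g t \<partial>lborel)
        + (\<integral>t. indicator {w<..2*w} t * g t \<partial>lborel) + (\<integral>t. indicator {2*w<..} t * g t \<partial>lborel)"
    proof -
      have "(\<integral>t. indicator {0..} t * g t \<partial>lborel) = (\<integral>t. indicator ?I t * g t
          + (indicator {w<..2*w} t * g t + indicator {2*w<..} t * g t) \<partial>lborel)"
        using w by (intro integral_cong_AE borel_measurable_integrable Bochner_Integration.integrable_add int0)
          (auto intro!: eventually_mono[OF AE_lborel_singleton[of w]] simp: indicator_def)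
      also have "\<dots> = (\<integral>t. indicator ?I t * g t \<partial>lborel)
          + (\<integral>t. indicator {w<..2*w} t * g t + indicator {2*w<..} t * g t \<partial>lborel)"
        by (intro Bochner_Integration.integral_add Bochner_Integration.integrable_add int0) auto
      also have "(\<integral>t. indicator {w<..2*w} t * g t + indicator {2*w<..} t * g t \<partial>lborel)
          = (\<integral>t. indicator {w<..2*w} t * g t \<partial>lborel) + (\<integral>t. indicator {2*w<..} t * g t \<partial>lborel)"
        by (intro Bochner_Integration.integral_add int0) auto
      finally show ?thesis by simp
    qed
    have refl: "(\<integral>t. indicator {w<..2*w} t * u t \<partial>lborel) = (\<integral>t. indicator ?I t * u (2 * w - t) \<partial>lborel)" for u :: "real \<Rightarrow> real"
    proof -
      have "(\<integral>t. indicator {w<..2*w} t * u t \<partial>lborel) = (\<integral>t. indicator {w<..2*w} (2 * w - t) * u (2 * w - t) \<partial>lborel)"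
        using lborel_integral_real_affine[of "-1" "\<lambda>t. indicator {w<..2*w} t * u t" "2 * w"] by simp
      also have "\<dots> = (\<integral>t. indicator ?I t * u (2 * w - t) \<partial>lborel)"
        by (intro Bochner_Integration.integral_cong) (auto simp: indicator_def)
      finally show ?thesis .
    qed
    have tail: "(\<integral>t. indicator {2*w<..} t * g t \<partial>lborel) \<le> F (2 * w) * (1 - Phi (2 * w))"
    proof -
      have "(\<integral>t. indicator {2*w<..} t * g t \<partial>lborel) \<le> (\<integral>t. F (2 * w) * (indicator {2*w<..} t * ?\<phi> t) \<partial>lborel)"
        using w by (intro integral_mono int0 integrable_mult_right measure_gaussian_eq_integral(1))
          (auto simp: indicator_def g_def intro!: mult_right_mono anti)
      also have "\<dots> = F (2 * w) * (1 - Phi (2 * w))"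
        by (simp add: measure_gaussian_eq_integral(2)[symmetric] meas_Ioi)
      finally show ?thesis .
    qed
    have int_refl: "integrable lborel (\<lambda>t. indicator ?I t * u (2 * w - t))"
      if "integrable lborel (\<lambda>t. indicator {w<..2*w} t * u t)" for u :: "real \<Rightarrow> real"
    proof -
      have "integrable lborel (\<lambda>t. indicator {w<..2*w} (2 * w + (- 1) * t) * u (2 * w + (- 1) * t))"
        using that by (rule lborel_integrable_real_affine) simp
      moreover have "(\<lambda>t. indicator {w<..2*w} (2 * w + (- 1) * t) * u (2 * w + (- 1) * t))
          = (\<lambda>t. indicator ?I t * u (2 * w - t))"
        by (auto simp: indicator_def)
      ultimately show ?thesis by (simp only:)
    qed
    note int1 = measure_gaussian_eq_integral(1)[of ?I, simplified]
    have int2: "integrable lborel (\<lambda>t. indicator ?I t * ?\<phi> (2 * w - t))"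
      by (intro int_refl measure_gaussian_eq_integral(1)) auto
    have "(\<integral>t. indicator ?I t * g t \<partial>lborel) + (\<integral>t. indicator {w<..2*w} t * g t \<partial>lborel)
        = (\<integral>t. indicator ?I t * g t + indicator ?I t * g (2 * w - t) \<partial>lborel)"
      unfolding refl by (intro Bochner_Integration.integral_add[symmetric] int0 int_refl) auto
    also have "\<dots> \<le> (\<integral>t. indicator ?I t * ?\<phi> t - F (2 * w) * (c * (indicator ?I t * ?\<phi> t) - indicator ?I t * ?\<phi> (2 * w - t)) \<partial>lborel)"
    proof (intro integral_mono Bochner_Integration.integrable_add Bochner_Integration.integrable_diff
        integrable_mult_right int0 int_refl int1 int2)
      fix t :: real
      \<comment> \<open>After inserting the pair bound, \<open>F (2 * w - t)\<close> carries the
        factor \<open>?\<phi> (2 * w - t) - c * ?\<phi> t\<close>, which is nonpositive as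
        \<open>c \<ge> 1\<close>; replacing it by the smaller constant \<open>F (2 * w)\<close>
        therefore increases the expression.\<close>
      have "g t + g (2 * w - t) \<le> ?\<phi> t - F (2 * w) * (c * ?\<phi> t - ?\<phi> (2 * w - t))" if t: "0 \<le> t" "t < w"
      proof -
        have "p * (F t + c * F (2 * w - t)) = p * F (w - (w - t)) + c * p * F (w + (w - t))"
          by (simp add: algebra_simps)
        also have "\<dots> \<le> p * 1"
          unfolding cp using pair[of "w - t"] t by simp
        finally have "p * (F t + c * F (2 * w - t)) \<le> p * 1" .
        then have sum: "F t + c * F (2 * w - t) \<le> 1"
          using \<open>p > 0\<close> by simp
        have "?\<phi> (2 * w - t) \<le> ?\<phi> t"
          using t by (intro gaussian_density_antimono) auto
        also have "\<dots> \<le> c * ?\<phi> t"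
          using \<open>c \<ge> 1\<close> mult_right_mono[of 1 c "?\<phi> t"] by simp
        finally have "F (2 * w) * (c * ?\<phi> t - ?\<phi> (2 * w - t)) \<le> F (2 * w - t) * (c * ?\<phi> t - ?\<phi> (2 * w - t))"
          using t by (intro mult_right_mono anti) auto
        moreover have "(F t + c * F (2 * w - t)) * ?\<phi> t \<le> 1 * ?\<phi> t"
          using sum by (intro mult_right_mono) auto
        ultimately show ?thesis
          by (simp add: g_def algebra_simps)
      qed
      then show "indicator ?I t * g t + indicator ?I t * g (2 * w - t)
          \<le> indicator ?I t * ?\<phi> t - F (2 * w) * (c * (indicator ?I t * ?\<phi> t) - indicator ?I t * ?\<phi> (2 * w - t))"
        by (auto simp: indicator_def)
    qed (auto intro!: measure_gaussian_eq_integral(1))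
    also have "\<dots> = p / 2 - F (2 * w) * (c * (p / 2) - (Phi (2 * w) - Phi w))"
    proof -
      have e1: "(\<integral>t. indicator ?I t * ?\<phi> t \<partial>lborel) = p / 2"
        using meas_Ico[of 0 w] w by (simp add: measure_gaussian_eq_integral(2) Pw Phi_0 field_simps)
      have e2: "(\<integral>t. indicator ?I t * ?\<phi> (2 * w - t) \<partial>lborel) = Phi (2 * w) - Phi w"
        using meas_Ioc[of w "2 * w"] w by (simp add: measure_gaussian_eq_integral(2) refl)
      show ?thesis
        using int1 int2 by (simp add: e2) (simp add: e1)
    qed
    \<comment> \<open>The coefficient of \<open>F (2 * w)\<close> cancels:
      \<open>c * (p / 2)\<close> equals \<open>1 - Phi w\<close>, the total mass of the two ranges
      beyond w.\<close>
    also have "\<dots> + F (2 * w) * (1 - Phi (2 * w)) = p / 2"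
    proof -
      have "c * (p / 2) = (1 - p) / 2"
        using cp by simp
      then show ?thesis
        unfolding Pw by (simp only:) (simp add: field_simps)
    qed
    finally show ?thesis
      using split tail by linarith
  qed
  finally show ?thesis by simp
qed

section \<open>Chords of a convex set\<close>

lemma nn_integral_lborel_translate:
  fixes f :: "'a::euclidean_space \<Rightarrow> ennreal"
  assumes [measurable]: "f \<in> borel_measurable borel"
  shows "(\<integral>\<^sup>+x. f (x + c) \<partial>lborel) = (\<integral>\<^sup>+x. f x \<partial>lborel)"
proof -
  have "(\<integral>\<^sup>+x. f x \<partial>lborel) = (\<integral>\<^sup>+x. f x \<partial>distr lborel borel ((+) c))"
    by (simp add: lborel_distr_plus)
  also have "\<dots> = (\<integral>\<^sup>+x. f (x + c) \<partial>lborel)"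
    by (subst nn_integral_distr) (auto simp: add.commute)
  finally show ?thesis by simp
qed

text \<open>A quarter turn in the plane spanned by \<open>e\<close> and the extra real axis is a product of three
  shears, so its measure invariance follows from translation invariance alone.\<close>

lemma nn_integral_quarter_turn:
  fixes H :: "'a::euclidean_space \<times> real \<Rightarrow> ennreal" and e :: 'a
  assumes H: "H \<in> borel_measurable borel" and e: "norm e = 1"
  shows "(\<integral>\<^sup>+x. \<integral>\<^sup>+z. H (x, z) \<partial>lborel \<partial>lborel)
    = (\<integral>\<^sup>+x. \<integral>\<^sup>+z. H (x - (x \<bullet> e) *\<^sub>R e + z *\<^sub>R e, - (x \<bullet> e)) \<partial>lborel \<partial>lborel)"
proof -
  define J where "J G = (\<integral>\<^sup>+x. \<integral>\<^sup>+z. G (x, z) \<partial>lborel \<partial>lborel)" for G :: "'a \<times> real \<Rightarrow> ennreal"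
  define T1 where "T1 = (\<lambda>(x, z). (x + z *\<^sub>R e, z))"
  define T2 where "T2 = (\<lambda>(x, z). (x, z - x \<bullet> e))"
  have T1m: "T1 \<in> borel_measurable borel" and T2m: "T2 \<in> borel_measurable borel"
    unfolding T1_def T2_def case_prod_beta
    by (intro borel_measurable_continuous_onI continuous_intros)+
  have sec: "(\<lambda>z. G (x, z)) \<in> borel_measurable borel" "(\<lambda>y. G (y, t)) \<in> borel_measurable borel"
    if "G \<in> borel_measurable borel" for G :: "'a \<times> real \<Rightarrow> ennreal" and x t
    by (rule measurable_compose[OF _ that], intro borel_measurable_continuous_onI continuous_intros)+
  have swap: "J G = (\<integral>\<^sup>+z. \<integral>\<^sup>+x. G (x, z) \<partial>lborel \<partial>lborel)" if "G \<in> borel_measurable borel" for G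
    unfolding J_def using that
    by (subst lborel_pair.Fubini') (auto simp: lborel_prod measurable_lborel2)
  have J1: "J (G \<circ> T1) = J G" if G: "G \<in> borel_measurable borel" for G
  proof -
    have "J (G \<circ> T1) = (\<integral>\<^sup>+z. \<integral>\<^sup>+x. G (x + z *\<^sub>R e, z) \<partial>lborel \<partial>lborel)"
      by (subst swap[OF measurable_comp[OF T1m G]]) (simp add: T1_def)
    also have "\<dots> = (\<integral>\<^sup>+z. \<integral>\<^sup>+x. G (x, z) \<partial>lborel \<partial>lborel)"
      using sec[OF G] by (intro nn_integral_cong nn_integral_lborel_translate)
    finally show ?thesis by (simp add: swap[OF G])
  qed
  have J2: "J (G \<circ> T2) = J G" if G: "G \<in> borel_measurable borel" for G
    unfolding J_def T2_def comp_def prod.case diff_conv_add_uminus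
    using sec[OF G] by (intro nn_integral_cong nn_integral_lborel_translate)
  have "J (H \<circ> T1 \<circ> T2 \<circ> T1) = J H"
    using J1[OF measurable_comp[OF T2m measurable_comp[OF T1m H]]]
      J2[OF measurable_comp[OF T1m H]] J1[OF H] by (simp add: comp_assoc)
  moreover have "(H \<circ> T1 \<circ> T2 \<circ> T1) (x, z) = H (x - (x \<bullet> e) *\<^sub>R e + z *\<^sub>R e, - (x \<bullet> e))" for x z
    using e by (simp add: T1_def T2_def inner_add_left norm_eq_1 algebra_simps)
  ultimately show ?thesis by (simp add: J_def)
qed

text \<open>The coordinate along e may be replaced by an independent standard normal one. A spare
  normal coordinate is adjoined and exchanged with it by a quarter turn, which preserves the product
  density; this makes a decomposition into e and its orthogonal complement unnecessary.\<close>

lemma emeasure_gaussian_resample: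
  fixes A :: "'a::euclidean_space set"
  assumes A: "A \<in> sets borel" and e: "norm e = 1"
  shows "emeasure gaussian_measure A
    = (\<integral>\<^sup>+x. emeasure gaussian_measure {z::real. x - (x \<bullet> e) *\<^sub>R e + z *\<^sub>R e \<in> A} \<partial>gaussian_measure)"
proof -
  note [measurable] = A
  define H where "H = (\<lambda>(x::'a, z::real). ennreal (gaussian_density x * gaussian_density z) * indicator A x)"
  have Hm: "H \<in> borel_measurable borel"
    unfolding H_def borel_prod[symmetric] by measurable
  have one: "(\<integral>\<^sup>+z. ennreal (gaussian_density (z::real)) \<partial>lborel) = 1"
    using gauss.emeasure_space_1[where 'a=real] by (simp add: emeasure_gaussian_measure)
  have "emeasure gaussian_measure A = (\<integral>\<^sup>+x. \<integral>\<^sup>+z. H (x, z) \<partial>lborel \<partial>lborel)"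
    by (simp add: H_def emeasure_gaussian_measure ennreal_mult mult.assoc nn_integral_cmult nn_integral_multc one)
  also have "\<dots> = (\<integral>\<^sup>+x. \<integral>\<^sup>+z. H (x - (x \<bullet> e) *\<^sub>R e + z *\<^sub>R e, - (x \<bullet> e)) \<partial>lborel \<partial>lborel)"
    by (rule nn_integral_quarter_turn[OF Hm e])
  also have "\<dots> = (\<integral>\<^sup>+x. \<integral>\<^sup>+z. ennreal (gaussian_density x) * (ennreal (gaussian_density z)
      * indicator {z. x - (x \<bullet> e) *\<^sub>R e + z *\<^sub>R e \<in> A} z) \<partial>lborel \<partial>lborel)"
  proof (intro nn_integral_cong)
    fix x :: 'a and z :: real
    define y where "y = x - (x \<bullet> e) *\<^sub>R e"
    have ye: "y \<bullet> e = 0"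
      using e by (simp add: y_def inner_diff_left norm_eq_1)
    have pyth: "(norm (y + a *\<^sub>R e))\<^sup>2 = (norm y)\<^sup>2 + a\<^sup>2" for a
      using ye e unfolding power2_norm_eq_inner
      by (simp add: inner_add_left inner_add_right inner_commute norm_eq_1 power2_eq_square)
    have "x = y + (x \<bullet> e) *\<^sub>R e" by (simp add: y_def)
    then have "(norm x)\<^sup>2 = (norm y)\<^sup>2 + (x \<bullet> e)\<^sup>2"
      using pyth by metis
    then have "gaussian_density (y + z *\<^sub>R e) * gaussian_density (- (x \<bullet> e)) = gaussian_density x * gaussian_density z"
      unfolding gaussian_density_def
      by (simp add: pyth add_divide_distrib diff_divide_distrib flip: exp_add)
    then show "H (x - (x \<bullet> e) *\<^sub>R e + z *\<^sub>R e, - (x \<bullet> e)) = ennreal (gaussian_density x) * (ennreal (gaussian_density z)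
      * indicator {z. x - (x \<bullet> e) *\<^sub>R e + z *\<^sub>R e \<in> A} z)"
      by (simp add: H_def y_def[symmetric] indicator_def flip: ennreal_mult)
  qed
  also have "\<dots> = (\<integral>\<^sup>+x. ennreal (gaussian_density x)
      * emeasure gaussian_measure {z::real. x - (x \<bullet> e) *\<^sub>R e + z *\<^sub>R e \<in> A} \<partial>lborel)"
    by (intro nn_integral_cong) (simp add: nn_integral_cmult emeasure_gaussian_measure)
  also have "\<dots> = (\<integral>\<^sup>+x. emeasure gaussian_measure {z::real. x - (x \<bullet> e) *\<^sub>R e + z *\<^sub>R e \<in> A} \<partial>gaussian_measure)"
  proof -
    have "Measurable.pred (borel \<Otimes>\<^sub>M borel) (\<lambda>(x, z). x - (x \<bullet> e) *\<^sub>R e + z *\<^sub>R e \<in> A)"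
      by measurable
    then have "{p \<in> space (borel \<Otimes>\<^sub>M gaussian_measure). fst p - (fst p \<bullet> e) *\<^sub>R e + snd p *\<^sub>R e \<in> A}
        \<in> sets (borel \<Otimes>\<^sub>M (gaussian_measure :: real measure))"
      unfolding pred_def sets_pair_measure_cong[OF refl sets_gaussian_measure]
      by (simp add: space_pair_measure case_prod_beta)
    then have "(\<lambda>x. emeasure (gaussian_measure :: real measure)
        (Pair x -` {p \<in> space (borel \<Otimes>\<^sub>M gaussian_measure). fst p - (fst p \<bullet> e) *\<^sub>R e + snd p *\<^sub>R e \<in> A}))
        \<in> borel_measurable borel"
      by (rule gauss.measurable_emeasure_Pair)
    then have "(\<lambda>x. emeasure (gaussian_measure :: real measure) {z. x - (x \<bullet> e) *\<^sub>R e + z *\<^sub>R e \<in> A}) \<in> borel_measurable borel"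
      by (simp add: space_pair_measure vimage_def)
    then show ?thesis
      unfolding gaussian_measure_eq_density[where 'a='a] by (subst nn_integral_density) auto
  qed
  finally show ?thesis .
qed

definition chord_set :: "'a::real_vector set \<Rightarrow> 'a \<Rightarrow> real \<Rightarrow> 'a set" where
  "chord_set K e t = {x. \<exists>s. x + s *\<^sub>R e \<in> K \<and> x + (s + 2 * t) *\<^sub>R e \<in> K}"

text \<open>Joint openness in point and length supplies the measurability for Tonelli's theorem as
  well as the openness of all sections.\<close>

lemma open_chord_set_pairs:
  fixes K :: "'a::euclidean_space set"
  assumes "open K"
  shows "open {(x, t). x \<in> chord_set K e t}"
proof -
  have "{(x, t). x \<in> chord_set K e t}
      = (\<Union>s. (\<lambda>p. fst p + s *\<^sub>R e) -` K \<inter> (\<lambda>p. fst p + (s + 2 * snd p) *\<^sub>R e) -` K)"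
    by (auto simp: chord_set_def)
  then show ?thesis
    using assms by (auto intro!: open_UN open_Int open_vimage continuous_intros)
qed

lemma open_chord_set:
  fixes K :: "'a::euclidean_space set"
  assumes "open K"
  shows "open (chord_set K e t)"
proof -
  have "open ((\<lambda>x. (x, t)) -` {(x, t). x \<in> chord_set K e t})"
    by (rule open_vimage[OF open_chord_set_pairs[OF assms]]) (intro continuous_intros)
  then show ?thesis by simp
qed

lemma chord_set_uminus [simp]: "chord_set K e (- t) = chord_set K e t"
proof -
  have "x \<in> chord_set K e (- t)" if "x \<in> chord_set K e t" for x t
    using that unfolding chord_set_def by clarsimp (rule_tac x="s + 2 * t" in exI, simp)
  from this[of _ t] this[of _ "- t"] show ?thesis by auto
qed

lemma chord_set_midpoint:
  assumes K: "convex K" and "x \<in> chord_set K e s" "y \<in> chord_set K e t"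
  shows "(1 / 2) *\<^sub>R (x + y) \<in> chord_set K e ((s + t) / 2)"
proof -
  obtain a b where a: "x + a *\<^sub>R e \<in> K" "x + (a + 2 * s) *\<^sub>R e \<in> K"
    and b: "y + b *\<^sub>R e \<in> K" "y + (b + 2 * t) *\<^sub>R e \<in> K"
    using assms(2,3) by (auto simp: chord_set_def)
  have "(1 / 2) *\<^sub>R (x + y) + ((a + b) / 2) *\<^sub>R e = (1 / 2) *\<^sub>R (x + a *\<^sub>R e) + (1 / 2) *\<^sub>R (y + b *\<^sub>R e)"
    by (simp add: algebra_simps add_divide_distrib)
  moreover have "(1 / 2) *\<^sub>R (x + y) + ((a + b) / 2 + 2 * ((s + t) / 2)) *\<^sub>R e
      = (1 / 2) *\<^sub>R (x + (a + 2 * s) *\<^sub>R e) + (1 / 2) *\<^sub>R (y + (b + 2 * t) *\<^sub>R e)"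
    by (simp add: algebra_simps add_divide_distrib)
  ultimately show ?thesis
    unfolding chord_set_def using convexD[OF K a(1) b(1)] convexD[OF K a(2) b(2)]
    by (intro CollectI exI[of _ "(a + b) / 2"]) simp
qed

lemma chord_set_antimono:
  assumes K: "convex K" and "0 \<le> s" "s \<le> t"
  shows "chord_set K e t \<subseteq> chord_set K e s"
proof
  fix x assume "x \<in> chord_set K e t"
  then obtain a where a: "x + a *\<^sub>R e \<in> K" "x + (a + 2 * t) *\<^sub>R e \<in> K"
    by (auto simp: chord_set_def)
  show "x \<in> chord_set K e s"
  proof (cases "t = 0")
    case False
    define u where "u = s / t"
    have u: "0 \<le> u" "u \<le> 1" "u * t = s"
      using assms False by (auto simp: u_def)
    have "(1 - u) *\<^sub>R (x + a *\<^sub>R e) + u *\<^sub>R (x + (a + 2 * t) *\<^sub>R e) \<in> K"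
      using u by (intro convexD[OF K a]) auto
    also have "(1 - u) *\<^sub>R (x + a *\<^sub>R e) + u *\<^sub>R (x + (a + 2 * t) *\<^sub>R e) = x + (a + 2 * (u * t)) *\<^sub>R e"
      by (simp add: algebra_simps)
    finally show ?thesis
      using a(1) u(3) by (auto simp: chord_set_def)
  qed (use assms a in \<open>auto simp: chord_set_def\<close>)
qed

lemma measure_le_by_Phi:
  fixes A :: "'a::euclidean_space set" and B :: "'b::euclidean_space set"
  assumes "\<And>a. Phi a \<le> measure gaussian_measure A \<Longrightarrow> Phi a \<le> measure gaussian_measure B"
  shows "measure gaussian_measure A \<le> measure gaussian_measure B"
proof (rule ccontr)
  assume "\<not> ?thesis"
  then obtain r where r: "measure gaussian_measure B < r" "r < measure gaussian_measure A"
    using dense[of "measure gaussian_measure B" "measure gaussian_measure A"] by (auto simp: not_le)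
  moreover have "0 < r"
    using r(1) measure_nonneg[of "gaussian_measure :: 'b measure" B] by linarith
  moreover have "r < 1"
    using r(2) gauss.prob_le_1[of A] by linarith
  ultimately obtain a where "Phi a = r"
    using Phi_surj by blast
  then show False
    using assms[of a] r by simp
qed

text \<open>Ehrhard's inequality applied to \<open>I\<close> and its reflection.\<close>

lemma measure_gaussian_le_half_difference:
  fixes I M :: "real set"
  assumes "open I" "open M" "\<And>a b. a \<in> I \<Longrightarrow> b \<in> I \<Longrightarrow> (b - a) / 2 \<in> M"
  shows "measure gaussian_measure I \<le> measure gaussian_measure M"
proof (rule measure_le_by_Phi)
  fix a assume a: "Phi a \<le> measure gaussian_measure I"
  have "Phi ((a + a) / 2) \<le> measure gaussian_measure M"
  proof (rule ehrhard_midpoint[OF assms(1) open_negations[OF assms(1)] assms(2) _ a])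
    show "Phi a \<le> measure gaussian_measure (uminus ` I)"
      using a assms(1) by (simp add: measure_gaussian_uminus)
  qed (use assms(3) in force)
  then show "Phi a \<le> measure gaussian_measure M" by simp
qed

text \<open>On a line in direction e, the half-differences of the points of the section of K are
  exactly those t for which the line belongs to \<open>chord_set K e t\<close>. The comparison of a
  section with its half-differences is integrated over the lines after resampling along e, and
  Tonelli's theorem exchanges lines and lengths.\<close>

lemma measure_gaussian_le_average_chord_set:
  fixes K :: "'a::euclidean_space set"
  assumes K: "open K" and e: "norm e = 1"
  shows "(\<lambda>t. measure gaussian_measure (chord_set K e t)) \<in> borel_measurable borel"
    and "measure gaussian_measure K
      \<le> (\<integral>t. measure gaussian_measure (chord_set K e t) \<partial>gaussian_measure)"
proof -
  let ?E = "{(x, t). x \<in> chord_set K e t}"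
  have Em: "?E \<in> sets ((gaussian_measure :: 'a measure) \<Otimes>\<^sub>M (gaussian_measure :: real measure))"
    using borel_open[OF open_chord_set_pairs[OF K, of e]]
    unfolding sets_pair_measure_cong[OF sets_gaussian_measure sets_gaussian_measure] borel_prod .
  interpret P: pair_sigma_finite "gaussian_measure :: 'a measure" "gaussian_measure :: real measure" ..
  have sec: "(\<lambda>x. (x, t)) -` ?E = chord_set K e t" "Pair x -` ?E = {t. x \<in> chord_set K e t}" for x t
    by auto
  have "(\<lambda>t. emeasure gaussian_measure (chord_set K e t)) \<in> borel_measurable borel"
    using P.measurable_emeasure_Pair2[OF Em] by (simp add: sec)
  then have "(\<lambda>t. enn2real (emeasure gaussian_measure (chord_set K e t))) \<in> borel_measurable borel"
    by measurable
  then show meas: "(\<lambda>t. measure gaussian_measure (chord_set K e t)) \<in> borel_measurable borel"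
    by (simp add: measure_def)
  have "emeasure gaussian_measure K
      = (\<integral>\<^sup>+x. emeasure gaussian_measure {z::real. x - (x \<bullet> e) *\<^sub>R e + z *\<^sub>R e \<in> K} \<partial>gaussian_measure)"
    using K by (intro emeasure_gaussian_resample e) auto
  also have "\<dots> \<le> (\<integral>\<^sup>+x. emeasure gaussian_measure {t. x \<in> chord_set K e t} \<partial>gaussian_measure)"
  proof (rule nn_integral_mono)
    fix x
    let ?I = "{z::real. x - (x \<bullet> e) *\<^sub>R e + z *\<^sub>R e \<in> K}"
    have "?I = (\<lambda>z. x - (x \<bullet> e) *\<^sub>R e + z *\<^sub>R e) -` K" by auto
    then have "open ?I"
      using K by (auto intro!: open_vimage continuous_intros)
    moreover have "open {t. x \<in> chord_set K e t}"
    proof -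
      have "open (Pair x -` ?E)"
        by (rule open_vimage[OF open_chord_set_pairs[OF K]]) (intro continuous_intros)
      then show ?thesis by simp
    qed
    moreover have "(b - a) / 2 \<in> {t. x \<in> chord_set K e t}" if "a \<in> ?I" "b \<in> ?I" for a b
    proof -
      have "a - x \<bullet> e + 2 * ((b - a) / 2) = b - x \<bullet> e" by (simp add: field_simps)
      then show ?thesis
        using that unfolding chord_set_def mem_Collect_eq
        by (intro exI[of _ "a - x \<bullet> e"]) (simp only:, simp add: algebra_simps)
    qed
    ultimately have "measure gaussian_measure ?I \<le> measure gaussian_measure {t. x \<in> chord_set K e t}"
      by (rule measure_gaussian_le_half_difference)
    then show "emeasure gaussian_measure ?I \<le> emeasure gaussian_measure {t. x \<in> chord_set K e t}"
      by (simp add: gauss.emeasure_eq_measure)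
  qed
  also have "\<dots> = emeasure ((gaussian_measure :: 'a measure) \<Otimes>\<^sub>M (gaussian_measure :: real measure)) ?E"
    by (simp add: gauss.emeasure_pair_measure_alt[OF Em] sec)
  also have "\<dots> = (\<integral>\<^sup>+t. emeasure gaussian_measure (chord_set K e t) \<partial>gaussian_measure)"
    by (simp add: P.emeasure_pair_measure_alt2[OF Em] sec)
  also have "\<dots> = ennreal (\<integral>t. measure gaussian_measure (chord_set K e t) \<partial>gaussian_measure)"
    using meas by (simp add: gauss.emeasure_eq_measure, subst nn_integral_eq_integral)
      (auto intro!: integrable_gaussian_bounded[where B=1])
  finally show "measure gaussian_measure K
      \<le> (\<integral>t. measure gaussian_measure (chord_set K e t) \<partial>gaussian_measure)"
    by (simp add: gauss.emeasure_eq_measure integral_nonneg)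
qed

lemma chord_set_measure_gt:
  fixes K :: "'a::euclidean_space set"
  assumes K: "open K" "convex K" and e: "norm e = 1" and w: "0 < w" and p: "Psi w \<le> 1 / 2"
    and big: "Psi w < measure gaussian_measure K"
  shows "Psi w < measure gaussian_measure (chord_set K e w)"
proof (rule ccontr)
  assume contra: "\<not> ?thesis"
  define F where "F t = measure gaussian_measure (chord_set K e t)" for t
  have Fw: "F w \<le> Psi w"
    using contra by (simp add: F_def)
  have "0 < Psi w"
    using Psi_eq[of w] w Phi_less_iff[of 0 w] by (simp add: Phi_0)
  have anti: "F t \<le> F s" if "0 \<le> s" "s \<le> t" for s t
    unfolding F_def using K that
    by (intro gauss.finite_measure_mono chord_set_antimono) (auto intro!: borel_open open_chord_set)
  have "(\<integral>t. F t \<partial>gaussian_measure) \<le> Psi w"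
  proof (rule gaussian_average_le[OF _ _ anti _ _ w refl p])
    show "F \<in> borel_measurable borel"
      unfolding F_def[abs_def] by (rule measure_gaussian_le_average_chord_set[OF K(1) e])
    fix \<delta> assume \<delta>: "0 \<le> \<delta>" "\<delta> \<le> w"
    show "Psi w * F (w - \<delta>) + (1 - Psi w) * F (w + \<delta>) \<le> Psi w"
    proof (rule midpoint_concave_pair[OF \<open>0 < Psi w\<close> p])
      show "F (w + \<delta>) \<le> Psi w"
        using anti[of w "w + \<delta>"] \<delta> w Fw by simp
      fix a b assume "Phi a \<le> F (w - \<delta>)" "Phi b \<le> F (w + \<delta>)"
      \<comment> \<open>Chords of half-lengths \<open>w - \<delta>\<close> and
        \<open>w + \<delta>\<close> average to a chord of half-length w.\<close>
      then have "Phi ((a + b) / 2) \<le> F w"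
        unfolding F_def using K(1) chord_set_midpoint[OF K(2), of _ e "w - \<delta>" _ "w + \<delta>"]
        by (intro ehrhard_midpoint[of "chord_set K e (w - \<delta>)" "chord_set K e (w + \<delta>)"]) (auto intro: open_chord_set)
      then show "Phi ((a + b) / 2) \<le> Psi w"
        using Fw by simp
    qed (auto simp: F_def)
  qed (auto simp: F_def)
  then show False
    using measure_gaussian_le_average_chord_set(2)[OF K(1) e] big by (simp add: F_def)
qed

section \<open>Lattice coverings\<close>

lemma convex_chord_set:
  assumes "convex K"
  shows "convex (chord_set K e t)"
proof (rule convexI)
  fix x y and u v :: real
  assume "x \<in> chord_set K e t" "y \<in> chord_set K e t" and uv: "0 \<le> u" "0 \<le> v" "u + v = 1"
  then obtain a b where a: "x + a *\<^sub>R e \<in> K" "x + (a + 2 * t) *\<^sub>R e \<in> K"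
    and b: "y + b *\<^sub>R e \<in> K" "y + (b + 2 * t) *\<^sub>R e \<in> K"
    by (auto simp: chord_set_def)
  have "u *\<^sub>R (x + a *\<^sub>R e) + v *\<^sub>R (y + b *\<^sub>R e) = u *\<^sub>R x + v *\<^sub>R y + (u * a + v * b) *\<^sub>R e"
    by (simp add: algebra_simps)
  moreover have "u *\<^sub>R (x + (a + 2 * t) *\<^sub>R e) + v *\<^sub>R (y + (b + 2 * t) *\<^sub>R e)
      = u *\<^sub>R x + v *\<^sub>R y + (u * a + v * b + 2 * t * (u + v)) *\<^sub>R e"
    by (simp add: algebra_simps)
  ultimately show "u *\<^sub>R x + v *\<^sub>R y \<in> chord_set K e t"
    using convexD[OF assms a(1) b(1) uv] convexD[OF assms a(2) b(2) uv] uv(3)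
    by (auto simp: chord_set_def intro!: exI[of _ "u * a + v * b"])
qed

lemma chord_set_scaleR:
  assumes "c \<noteq> 0"
  shows "chord_set K (c *\<^sub>R e) t = chord_set K e (c * t)"
proof -
  have "(\<exists>s. x + (s * c) *\<^sub>R e \<in> K \<and> x + ((s + 2 * t) * c) *\<^sub>R e \<in> K)
      \<longleftrightarrow> (\<exists>s. x + s *\<^sub>R e \<in> K \<and> x + (s + 2 * (c * t)) *\<^sub>R e \<in> K)" (is "?L \<longleftrightarrow> ?R") for x
  proof
    assume ?L
    then obtain s where "x + (s * c) *\<^sub>R e \<in> K" "x + ((s + 2 * t) * c) *\<^sub>R e \<in> K" by blast
    then show ?R by (intro exI[of _ "s * c"]) (simp add: algebra_simps)
  next
    assume ?R
    then obtain s where "x + s *\<^sub>R e \<in> K" "x + (s + 2 * (c * t)) *\<^sub>R e \<in> K" by blast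
    then show ?L using assms by (intro exI[of _ "s / c"]) (simp add: algebra_simps)
  qed
  then show ?thesis by (simp add: chord_set_def)
qed

lemma of_int_scaleR_mem:
  fixes G :: "'a::real_vector set"
  assumes G: "0 \<in> G" "\<And>x y. x \<in> G \<Longrightarrow> y \<in> G \<Longrightarrow> x + y \<in> G" "\<And>x. x \<in> G \<Longrightarrow> - x \<in> G" and "v \<in> G"
  shows "of_int m *\<^sub>R v \<in> G"
proof -
  have nat: "real n *\<^sub>R v \<in> G" for n
    by (induction n) (auto simp: scaleR_add_left G \<open>v \<in> G\<close>)
  show ?thesis
  proof (cases "m \<ge> 0")
    case True
    then show ?thesis using nat[of "nat m"] by simp
  next
    case False
    then show ?thesis using G(3)[OF nat[of "nat (- m)"]] by simp
  qed
qed

text \<open>The generators are eliminated one at a time. Invariance of \<open>K\<close> under the span \<open>V\<close> of the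
  eliminated ones allows each new generator to be replaced by its component orthogonal to \<open>V\<close>.\<close>

lemma covering_by_short_generators:
  fixes K V S G :: "'a::euclidean_space set"
  assumes w: "0 < w" "Psi w \<le> 1 / 2"
    and G: "0 \<in> G" "\<And>x y. x \<in> G \<Longrightarrow> y \<in> G \<Longrightarrow> x + y \<in> G" "\<And>x. x \<in> G \<Longrightarrow> - x \<in> G"
    and "finite S" "S \<subseteq> G" "\<And>v. v \<in> S \<Longrightarrow> norm v \<le> 2 * w"
    and "open K" "convex K" "Psi w < measure gaussian_measure K"
    and "subspace V" "\<And>x y. x \<in> K \<Longrightarrow> y \<in> V \<Longrightarrow> x + y \<in> K" "span (V \<union> S) = UNIV"
  shows "\<exists>k\<in>K. \<exists>l\<in>G. x = k + l"
  using assms(6-)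
proof (induction S arbitrary: K V x rule: finite_induct)
  case empty
  \<comment> \<open>With no generator left, K is nonempty and invariant under all translations,
    hence the whole space.\<close>
  then have "V = UNIV"
    by (metis span_eq_iff sup_bot_right)
  moreover have "K \<noteq> {}"
  proof
    assume "K = {}"
    with empty.prems(5) have "Psi w < 0" by simp
    then show False by (simp add: Psi_def not_less[symmetric])
  qed
  then obtain k where "k \<in> K" by blast
  ultimately have "k + (x - k) \<in> K"
    using empty.prems(7) by blast
  then show ?case
    using G(1) by (intro bexI[of _ x] bexI[of _ 0]) auto
next
  case (insert v S)
  obtain y u where yu: "y \<in> span V" "\<And>z. z \<in> span V \<Longrightarrow> orthogonal u z" "v = y + u"
    using orthogonal_subspace_decomp_exists[of V v] by blast
  have "span V = V"
    using insert.prems(6) by (simp add: span_eq_iff)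
  with yu have yV: "y \<in> V" by simp
  have span_grow: "span (V' \<union> S) = UNIV" if "V \<subseteq> V'" "u \<in> V'" "subspace V'" for V'
  proof -
    have "v \<in> V'"
      unfolding yu(3) using yV that by (auto intro: subspace_add)
    then have "V \<union> insert v S \<subseteq> span (V' \<union> S)"
      using that by (auto intro: span_base)
    then have "span (V \<union> insert v S) \<subseteq> span (V' \<union> S)"
      by (rule span_minimal) (rule subspace_span)
    then show ?thesis
      using insert.prems(8) by auto
  qed
  show ?case
  proof (cases "u = 0")
    case True
    then have "span (V \<union> S) = UNIV"
      using insert.prems(6) by (intro span_grow) (auto intro: subspace_0)
    then show ?thesis
      using insert.prems by (intro insert.IH[of K V]) auto
  next
    case False
    \<comment> \<open>Projection only shortens, so the orthogonal component u inherits the length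
      bound of the generator v.\<close>
    have "(norm v)\<^sup>2 = (norm u)\<^sup>2 + (norm y)\<^sup>2"
      using norm_add_Pythagorean[of u y] yu by (simp add: add.commute)
    then have "(norm u)\<^sup>2 \<le> (norm v)\<^sup>2" by simp
    then have nu: "norm u \<le> 2 * w"
      using insert.prems(2)[of v] by (simp add: power2_le_iff_abs_le)
    \<comment> \<open>Half-length 1/2 in units of u means chords containing a full period of the
      translation by u.\<close>
    define K' where "K' = chord_set K u (1 / 2)"
    define e where "e = u /\<^sub>R norm u"
    have e: "norm e = 1" "u = norm u *\<^sub>R e"
      using False by (auto simp: e_def)
    have K'_eq: "K' = chord_set K e (norm u * (1 / 2))"
      unfolding K'_def using chord_set_scaleR[of "norm u" K e "1 / 2"] False e(2) by simp
    have "chord_set K e w \<subseteq> K'"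
      unfolding K'_eq using nu insert.prems(4) by (intro chord_set_antimono) auto
    moreover have "open K'"
      unfolding K'_def using insert.prems(3) by (rule open_chord_set)
    ultimately have "measure gaussian_measure (chord_set K e w) \<le> measure gaussian_measure K'"
      by (intro gauss.finite_measure_mono) auto
    with chord_set_measure_gt[OF insert.prems(3,4) e(1) w insert.prems(5)]
    have big: "Psi w < measure gaussian_measure K'" by linarith
    define V' where "V' = span (insert u V)"
    have inv: "a + b \<in> K'" if a: "a \<in> K'" and b: "b \<in> V'" for a b
    proof -
      obtain r where r: "b - r *\<^sub>R u \<in> V"
        using b \<open>span V = V\<close> by (auto simp: V'_def span_breakdown_eq)
      obtain s where s: "a + s *\<^sub>R u \<in> K" "a + (s + 2 * (1 / 2)) *\<^sub>R u \<in> K"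
        using a by (auto simp: K'_def chord_set_def)
      \<comment> \<open>The component \<open>r *\<^sub>R u\<close> of b slides the starting
        parameter of the chord by r; the rest of b lies in V and preserves K.\<close>
      have eqs: "a + b + (s - r) *\<^sub>R u = (a + s *\<^sub>R u) + (b - r *\<^sub>R u)"
        "a + b + (s - r + 2 * (1 / 2)) *\<^sub>R u = (a + (s + 2 * (1 / 2)) *\<^sub>R u) + (b - r *\<^sub>R u)"
        by (simp_all add: algebra_simps)
      show ?thesis
        using insert.prems(7)[OF s(1) r] insert.prems(7)[OF s(2) r]
        unfolding K'_def chord_set_def by (intro CollectI exI[of _ "s - r"]) (simp only: eqs)
    qed
    have "\<exists>k\<in>K'. \<exists>l\<in>G. x = k + l"
    proof (rule insert.IH)
      show "convex K'"
        unfolding K'_def using insert.prems(4) by (rule convex_chord_set)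
      show "span (V' \<union> S) = UNIV"
        by (intro span_grow) (auto simp: V'_def intro: span_base)
    qed (use insert.prems \<open>open K'\<close> big inv in \<open>auto simp: V'_def\<close>)
    then obtain k l where kl: "k \<in> K'" "l \<in> G" "x = k + l" by blast
    then obtain s where s: "k + s *\<^sub>R u \<in> K" "k + (s + 1) *\<^sub>R u \<in> K"
      by (auto simp: K'_def chord_set_def)
    \<comment> \<open>The chord covers the parameters from s to \<open>s + 1\<close>, and this
      interval contains an integer.\<close>
    define m where "m = \<lceil>s\<rceil>"
    have m: "s \<le> of_int m" "of_int m \<le> s + 1"
      by (auto simp: m_def)
    define t where "t = of_int m - s"
    have "(1 - t) *\<^sub>R (k + s *\<^sub>R u) + t *\<^sub>R (k + (s + 1) *\<^sub>R u) \<in> K"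
      using m by (intro convexD[OF insert.prems(4) s]) (auto simp: t_def)
    also have "(1 - t) *\<^sub>R (k + s *\<^sub>R u) + t *\<^sub>R (k + (s + 1) *\<^sub>R u) = k + (s + t) *\<^sub>R u"
      by (simp add: algebra_simps)
    finally have "k + of_int m *\<^sub>R u \<in> K"
      by (simp add: t_def)
    \<comment> \<open>The component u need not lie in G. Adding m times y, a vector of V, stays in K
      and turns the multiple of u into the same multiple of v, which does lie in G.\<close>
    then have "k + of_int m *\<^sub>R u + of_int m *\<^sub>R y \<in> K"
      using insert.prems(6,7) yV by (simp add: subspace_scale)
    then have "k + of_int m *\<^sub>R v \<in> K"
      by (simp add: yu(3) algebra_simps)
    moreover have "l + - (of_int m *\<^sub>R v) \<in> G"
      using insert.prems(1) kl(2) G by (intro G(2) G(3) of_int_scaleR_mem) auto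
    moreover have "x = (k + of_int m *\<^sub>R v) + (l + - (of_int m *\<^sub>R v))"
      using kl(3) by simp
    ultimately show ?thesis by blast
  qed
qed

section \<open>From the covering statement to the lattice constants\<close>

lemma Psi_strict_mono: "0 \<le> x \<Longrightarrow> x < y \<Longrightarrow> Psi x < Psi y"
  by (simp add: Psi_eq)

lemma Psi_inv_works:
  assumes "0 < p" "p < 1"
  shows "0 < Psi_inv p" "Psi (Psi_inv p) = p"
proof -
  obtain x where x: "Phi x = (1 + p) / 2"
    using Phi_surj[of "(1 + p) / 2"] assms by auto
  then have "0 < x"
    using Phi_less_iff[of 0 x] assms by (simp add: Phi_0)
  have "inj_on Psi {0..}"
    by (rule inj_onI) (simp add: Psi_eq)
  then have "Psi_inv p = x"
    unfolding Psi_inv_def using \<open>0 < x\<close> x by (intro the_inv_into_f_eq) (auto simp: Psi_eq)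
  with x \<open>0 < x\<close> show "0 < Psi_inv p" "Psi (Psi_inv p) = p"
    by (auto simp: Psi_eq)
qed

text \<open>The frontier of a convex set is Lebesgue null. This passes from the closed body to an
  open one, as the chord argument requires.\<close>

lemma measure_gaussian_interior:
  fixes K :: "'a::euclidean_space set"
  assumes "closed K" "convex K"
  shows "measure gaussian_measure (interior K) = measure gaussian_measure K"
proof -
  have fr: "frontier K \<in> null_sets lborel"
    using negligible_convex_frontier[OF assms(2)]
    by (simp add: negligible_iff_null_sets null_sets_completion_iff)
  have "emeasure gaussian_measure (frontier K) = (\<integral>\<^sup>+x\<in>frontier K. ennreal (gaussian_density x) \<partial>lborel)"
    by (rule emeasure_gaussian_measure) auto
  also have "\<dots> = 0"
    by (rule nn_integral_null_set[OF fr])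
  finally have "measure gaussian_measure (frontier K) = 0"
    by (simp add: measure_def)
  moreover have "measure gaussian_measure (interior K \<union> frontier K)
      = measure gaussian_measure (interior K) + measure gaussian_measure (frontier K)"
    by (rule gauss.finite_measure_Union) (auto simp: frontier_def)
  moreover have "interior K \<union> frontier K = K"
    using assms(1) by (simp add: frontier_def Un_absorb1 interior_subset)
  ultimately show ?thesis by simp
qed

text \<open>The group law transports isolation of the origin to a uniform separation of all points,
  which makes L closed; a compact discrete set is finite.\<close>

lemma full_lattice_finite_cball:
  assumes L: "full_lattice L"
  shows "finite (L \<inter> cball 0 r)"
proof -
  have "topological_space_class.discrete L" "0 \<in> L"
    using L by (auto simp: full_lattice_def)
  then obtain e where e: "e > 0" "\<And>y. y \<in> L \<Longrightarrow> dist 0 y < e \<Longrightarrow> y = 0"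
    using isolated_in_dist_Ex_iff[of 0 L] by (auto dest: discreteD)
  have "x = y" if "x \<in> L" "y \<in> L" "dist x y < e" for x y
  proof -
    have "y + - x \<in> L"
      using L that by (simp only: full_lattice_def)
    then have "y + - x = 0"
      using that by (intro e(2)) (simp_all add: dist_norm norm_minus_commute)
    then show ?thesis by simp
  qed
  then have "uniform_discrete L"
    using e(1) by (auto simp: uniform_discrete_def)
  then have "compact (L \<inter> cball 0 r)"
    by (intro closed_Int_compact uniform_discrete_imp_closed compact_cball)
  moreover have "topological_space_class.discrete (L \<inter> cball 0 r)"
    using \<open>topological_space_class.discrete L\<close> by (rule discrete_subset) auto
  ultimately show ?thesis
    using discrete_compact_finite_iff by blast
qed

text \<open>A \<open>LEAST\<close> over the reals is meaningful only if the minimum exists. Bases no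
  longer than a given one lie in a ball with finitely many lattice points, so only finitely many
  compete.\<close>

lemma last_successive_minimum_attained:
  fixes L :: "'a::euclidean_space set"
  assumes L: "full_lattice L"
  obtains S where "0 < last_successive_minimum L (cball 0 1)" "S \<subseteq> L" "independent S" "card S = DIM('a)"
    "\<And>v. v \<in> S \<Longrightarrow> norm v \<le> last_successive_minimum L (cball 0 1)"
proof -
  define B where "B S \<longleftrightarrow> S \<subseteq> L \<and> independent S \<and> card S = DIM('a)" for S
  define M where "M S = Max (norm ` S)" for S :: "'a set"
  have B_fin: "finite S" "S \<noteq> {}" if "B S" for S
    using that by (auto simp: B_def independent_imp_finite)
  have norm_le: "norm v \<le> M S" if "B S" "v \<in> S" for S v
    unfolding M_def using that B_fin[of S] by (intro Max_ge) auto
  have M_le: "M S \<le> c \<longleftrightarrow> (\<forall>v\<in>S. norm v \<le> c)" if "B S" for S c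
    unfolding M_def using B_fin[OF that] by (simp add: Max_le_iff)
  have M_pos: "M S > 0" if S: "B S" for S
  proof -
    obtain v where v: "v \<in> S" using B_fin[OF S] by blast
    then have "v \<noteq> 0"
      using S dependent_zero by (auto simp: B_def)
    then show ?thesis
      using norm_le[OF S v] by (smt (verit) zero_less_norm_iff)
  qed
  obtain S0 where S0: "S0 \<subseteq> L" "independent S0" "L \<subseteq> span S0" "card S0 = dim L"
    by (rule basis_exists)
  have "dim L = DIM('a)"
    using L by (simp add: full_lattice_def dim_eq_full)
  with S0 have "B S0" by (simp add: B_def)
  define F where "F = {S. B S \<and> M S \<le> M S0}"
  have "F \<subseteq> Pow (L \<inter> cball 0 (M S0))"
    using M_le by (auto simp: F_def B_def)
  then have "finite F"
    by (rule finite_subset) (simp only: finite_Pow_iff full_lattice_finite_cball[OF L])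
  moreover have "S0 \<in> F"
    using \<open>B S0\<close> by (simp add: F_def)
  ultimately obtain S where S: "S \<in> F" "\<And>T. T \<in> F \<Longrightarrow> M S \<le> M T"
    using ex_min_if_finite[of "M ` F"] by (metis (mono_tags, lifting) arg_min_if_finite(1) arg_min_least empty_iff)
  then have "B S" by (simp add: F_def)
  have best: "M S \<le> M T" if "B T" for T
    using S that by (cases "M T \<le> M S0") (auto simp: F_def)
  have scaled: "(*\<^sub>R) c ` cball (0::'a) 1 = cball 0 c" if "c > 0" for c
    using cball_scale[of c "0::'a" 1] that by simp
  have "last_successive_minimum L (cball 0 1) = M S"
    unfolding last_successive_minimum_def
  proof (rule Least_equality)
    show "M S > 0 \<and> (\<exists>S'. S' \<subseteq> L \<inter> (*\<^sub>R) (M S) ` cball 0 1 \<and> independent S' \<and> card S' = DIM('a))"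
      using M_pos[OF \<open>B S\<close>] \<open>B S\<close> norm_le[OF \<open>B S\<close>]
      by (auto simp: scaled B_def intro!: exI[of _ S])
  next
    fix c assume c: "c > 0 \<and> (\<exists>S'. S' \<subseteq> L \<inter> (*\<^sub>R) c ` cball 0 1 \<and> independent S' \<and> card S' = DIM('a))"
    then obtain T where "B T" "T \<subseteq> cball 0 c"
      by (auto simp: scaled B_def)
    then show "M S \<le> c"
      using best[of T] M_le[of T c] by fastforce
  qed
  then show thesis
    using that[of S] M_pos[OF \<open>B S\<close>] \<open>B S\<close> norm_le[OF \<open>B S\<close>] by (simp add: B_def)
qed

text \<open>Everything is divided by c. Since c strictly exceeds the bound, the generators then have
  length at most \<open>2 * w\<close> with \<open>w < w0\<close>, which supplies the strict
  inequality between measures that the elimination of generators preserves.\<close>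

lemma lattice_covering:
  fixes K :: "'a::euclidean_space set"
  assumes L: "full_lattice L" and K: "closed K" "convex K" "measure gaussian_measure K > 0"
    and c: "last_successive_minimum L (cball 0 1) * gaussian_bound (measure gaussian_measure K) < c"
  shows "L + (*\<^sub>R) c ` K = UNIV"
proof -
  define rho where "rho = last_successive_minimum L (cball 0 1)"
  obtain S where S: "0 < rho" "S \<subseteq> L" "independent S" "card S = DIM('a)" "\<And>v. v \<in> S \<Longrightarrow> norm v \<le> rho"
    using last_successive_minimum_attained[OF L] unfolding rho_def by blast
  \<comment> \<open>Truncation at 1/2 merges the two cases of the bound and ensures
    \<open>Psi w \<le> 1 / 2\<close>.\<close>
  define p where "p = min (measure gaussian_measure K) (1 / 2)"
  have p: "0 < p" "p \<le> 1 / 2" "p \<le> measure gaussian_measure K"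
    using K by (auto simp: p_def)
  define w0 where "w0 = Psi_inv p"
  have w0: "0 < w0" "Psi w0 = p"
    using Psi_inv_works[of p] p by (auto simp: w0_def)
  have "gaussian_bound (measure gaussian_measure K) = 1 / (2 * w0)"
    by (auto simp: gaussian_bound_def w0_def p_def)
  then have c': "rho / (2 * w0) < c"
    using c by (simp add: rho_def)
  have "0 < rho / (2 * w0)"
    using S(1) w0 by simp
  then have "c > 0"
    using c' by linarith
  define w where "w = rho / (2 * c)"
  have w: "0 < w" "w < w0"
    using S(1) \<open>c > 0\<close> w0 c' by (auto simp: w_def field_simps)
  have Pw: "Psi w < p"
    using Psi_strict_mono[of w w0] w w0 by simp
  have "finite S"
    using S(3) by (rule independent_imp_finite)
  have "span S = UNIV"
    using S(3,4) dim_eq_card_independent[OF S(3)] dim_eq_full[of S] by simp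
  have fin': "finite ((*\<^sub>R) (1 / c) ` S)"
    using \<open>finite S\<close> by simp
  have sp: "span ({0} \<union> (*\<^sub>R) (1 / c) ` S) = UNIV"
    using span_image_scale[of S "\<lambda>_. 1 / c"] \<open>finite S\<close> \<open>c > 0\<close> \<open>span S = UNIV\<close> by (simp add: span_insert_0)
  have "\<exists>k\<in>interior K. \<exists>l\<in>(*\<^sub>R) (1 / c) ` L. (1 / c) *\<^sub>R x = k + l" for x
  proof (rule covering_by_short_generators[where w=w and V="{0}" and S="(*\<^sub>R) (1 / c) ` S"])
    show "0 \<in> (*\<^sub>R) (1 / c) ` L"
      using L by (auto simp: full_lattice_def image_iff intro!: bexI[of _ 0])
    show "a + b \<in> (*\<^sub>R) (1 / c) ` L" if "a \<in> (*\<^sub>R) (1 / c) ` L" "b \<in> (*\<^sub>R) (1 / c) ` L" for a b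
      using that L by (auto simp: full_lattice_def simp flip: scaleR_add_right)
    show "- a \<in> (*\<^sub>R) (1 / c) ` L" if "a \<in> (*\<^sub>R) (1 / c) ` L" for a
      using that L by (auto simp: full_lattice_def simp flip: scaleR_minus_right)
    show "norm v \<le> 2 * w" if "v \<in> (*\<^sub>R) (1 / c) ` S" for v
      using that S(5) \<open>c > 0\<close> by (auto simp: w_def divide_right_mono)
    show "Psi w < measure gaussian_measure (interior K)"
      using Pw p K by (simp add: measure_gaussian_interior)
  qed (use w Pw p K S(2) fin' sp in \<open>auto simp: convex_interior\<close>)
  then have "\<exists>l\<in>L. \<exists>k\<in>K. x = l + c *\<^sub>R k" for x
  proof -
    obtain k l where kl: "k \<in> interior K" "l \<in> L" "(1 / c) *\<^sub>R x = k + (1 / c) *\<^sub>R l"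
      using \<open>\<And>x. \<exists>k\<in>interior K. \<exists>l\<in>(*\<^sub>R) (1 / c) ` L. (1 / c) *\<^sub>R x = k + l\<close>[of x] by blast
    have "x = c *\<^sub>R ((1 / c) *\<^sub>R x)"
      using \<open>c > 0\<close> by simp
    also have "\<dots> = l + c *\<^sub>R k"
      unfolding kl(3) using \<open>c > 0\<close> by (simp add: scaleR_add_right)
    finally show ?thesis
      using kl interior_subset by blast
  qed
  then show ?thesis
    by (auto simp: set_plus_def)
qed

theorem theorem2:
  fixes K :: "(real ^ 'n) set"
  assumes "closed K" and "convex K" and "measure gaussian_measure K > 0"
  shows "alpha (cball 0 1) K \<le> ereal (gaussian_bound (measure gaussian_measure K))"
  unfolding alpha_def
proof (rule SUP_least)
  fix L :: "(real ^ 'n) set" assume "L \<in> {L. full_lattice L}"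
  then have L: "full_lattice L" by simp
  define rho where "rho = last_successive_minimum L (cball 0 1)"
  define b where "b = gaussian_bound (measure gaussian_measure K)"
  have "rho > 0"
    unfolding rho_def by (rule last_successive_minimum_attained[OF L])
  have "b \<ge> 0"
    using Psi_inv_works[of "1 / 2"] Psi_inv_works[of "measure gaussian_measure K"] assms(3)
    by (auto simp: b_def gaussian_bound_def less_imp_le)
  \<comment> \<open>Coverings are available only strictly above \<open>rho * b\<close>; letting
    \<epsilon> tend to 0 recovers the bound for the infimum.\<close>
  have *: "covering_radius L K \<le> ereal (rho * b) + ereal \<epsilon>" if "\<epsilon> > 0" for \<epsilon>
  proof -
    have "L + (*\<^sub>R) (rho * b + \<epsilon>) ` K = UNIV"
      using that by (intro lattice_covering[OF L assms]) (simp add: rho_def b_def)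
    moreover have "rho * b + \<epsilon> > 0"
      using \<open>rho > 0\<close> \<open>b \<ge> 0\<close> that by (simp add: add_nonneg_pos)
    ultimately show ?thesis
      unfolding covering_radius_def by (intro Inf_lower) auto
  qed
  have "covering_radius L K \<le> ereal (rho * b)"
    by (rule ereal_le_epsilon2) (rule *)
  then show "covering_radius L K / ereal (last_successive_minimum L (cball 0 1)) \<le> ereal (gaussian_bound (measure gaussian_measure K))"
    using \<open>rho > 0\<close> by (simp add: ereal_divide_le_pos flip: rho_def b_def)
qed

end
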